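(* Non-Terminal Spanning Tree admits a quadratic vertex kernel when parameterized by the max leaf number: there is a polynomial-time algorithm that, given an instance $(G, V_{\rm NT})$, outputs an equivalent instance of Non-Terminal Spanning Tree whose graph has $O(\mathtt{ml}(G)^2)$ vertices.
   Context: Non-Terminal Spanning Tree: given a connected undirected graph $G=(V,E)$ and a set $V_{\rm NT}\subseteq V$ with $|V_{\rm NT}| \le |V|-2$, decide whether $G$ has a spanning tree $T$ in which every vertex of $V_{\rm NT}$ has degree at least $2$. The max leaf number $\mathtt{ml}(G)$ is the maximum number of leaves (degree-$1$ vertices) of a spanning tree of $G$. Two instances are equivalent if both are yes-instances or both are no-instances. *)

theory Defs
  imports "HOL-Computational_Algebra.Polynomial"
begin

section \<open>Undirected graphs\<close>

text \<open>A finite simple undirected graph is given by its vertex set and its set of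
  two-element edges.\<close>

definition simple_graph :: "'a set \<Rightarrow> 'a set set \<Rightarrow> bool" where
  "simple_graph V E \<longleftrightarrow> finite V \<and> (\<forall>e\<in>E. e \<subseteq> V \<and> card e = 2)"

definition connected_graph :: "'a set \<Rightarrow> 'a set set \<Rightarrow> bool" where
  "connected_graph V E \<longleftrightarrow>
     V \<noteq> {} \<and> (\<forall>u\<in>V. \<forall>v\<in>V. (u, v) \<in> {(x, y). {x, y} \<in> E}\<^sup>*)"

definition cycle_in :: "'a set set \<Rightarrow> 'a list \<Rightarrow> bool" where
  "cycle_in E c \<longleftrightarrow> length c \<ge> 3 \<and> distinct c \<and>
     (\<forall>i<length c. {c ! i, c ! (Suc i mod length c)} \<in> E)"

definition tree_graph :: "'a set \<Rightarrow> 'a set set \<Rightarrow> bool" where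
  "tree_graph V E \<longleftrightarrow> simple_graph V E \<and> connected_graph V E \<and> (\<nexists>c. cycle_in E c)"

definition spanning_tree :: "'a set \<Rightarrow> 'a set set \<Rightarrow> 'a set set \<Rightarrow> bool" where
  "spanning_tree V E T \<longleftrightarrow> T \<subseteq> E \<and> tree_graph V T"

definition vdegree :: "'a set set \<Rightarrow> 'a \<Rightarrow> nat" where
  "vdegree E v = card {e \<in> E. v \<in> e}"

definition leaves :: "'a set \<Rightarrow> 'a set set \<Rightarrow> 'a set" where
  "leaves V T = {v \<in> V. vdegree T v = 1}"

text \<open>The maximum below is over a nonempty finite set whenever the (finite simple) graph is
  connected, which is the only case in which it is used.\<close>

definition max_leaf_number :: "'a set \<Rightarrow> 'a set set \<Rightarrow> nat" where
  "max_leaf_number V E = Max {card (leaves V T) | T. spanning_tree V E T}"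

section \<open>Non-Terminal Spanning Tree\<close>

definition ntst_instance :: "'a set \<Rightarrow> 'a set set \<Rightarrow> 'a set \<Rightarrow> bool" where
  "ntst_instance V E N \<longleftrightarrow>
     simple_graph V E \<and> connected_graph V E \<and> N \<subseteq> V \<and> card N + 2 \<le> card V"

definition ntst_yes :: "'a set \<Rightarrow> 'a set set \<Rightarrow> 'a set \<Rightarrow> bool" where
  "ntst_yes V E N \<longleftrightarrow> (\<exists>T. spanning_tree V E T \<and> (\<forall>v\<in>N. vdegree T v \<ge> 2))"

section \<open>A model of polynomial-time computation\<close>

text \<open>Algorithms are programs of a deterministic first-order functional language with
  call-by-value recursion over binary trees, in the style of the languages WHILE and F of
  N. D. Jones (\<^emph>\<open>Computability and Complexity from a Programming Perspective\<close>).
  Only constant-time primitives are available (constructing a cell, selecting a component,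
  testing for \<open>Null\<close>), and each of them, each argument access and each call costs one
  time unit.\<close>

datatype data = Null | Cell data data

fun head :: "data \<Rightarrow> data" where
  "head Null = Null"
| "head (Cell a b) = a"

fun tail :: "data \<Rightarrow> data" where
  "tail Null = Null"
| "tail (Cell a b) = b"

datatype expr =
    EArg nat
  | ENull
  | ECell expr expr
  | EHead expr
  | ETail expr
  | EIf expr expr expr
  | ECall nat "expr list"

text \<open>A program lists the bodies of its functions. In the body of a function, \<open>EArg i\<close> denotes
  its \<open>i\<close>-th argument, and \<open>ECall f es\<close> calls the \<open>f\<close>-th function; function \<open>0\<close> is the entry
  point. \<open>EIf\<close> takes its second branch if the condition evaluates to \<open>Null\<close> and its first
  branch otherwise.\<close>

type_synonym program = "expr list"

text \<open>\<open>eval P \<rho> e v t\<close>: in program \<open>P\<close>, with argument values \<open>\<rho>\<close>, the expression \<open>e\<close> evaluates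
  to \<open>v\<close> in \<open>t\<close> steps. A nonterminating or stuck evaluation has no derivation.\<close>

inductive eval :: "program \<Rightarrow> data list \<Rightarrow> expr \<Rightarrow> data \<Rightarrow> nat \<Rightarrow> bool"
  and evals :: "program \<Rightarrow> data list \<Rightarrow> expr list \<Rightarrow> data list \<Rightarrow> nat \<Rightarrow> bool"
  for P :: program
where
  eval_Arg: "i < length \<rho> \<Longrightarrow> eval P \<rho> (EArg i) (\<rho> ! i) 1"
| eval_Null: "eval P \<rho> ENull Null 1"
| eval_Cell: "\<lbrakk> eval P \<rho> e1 v1 t1; eval P \<rho> e2 v2 t2 \<rbrakk>
    \<Longrightarrow> eval P \<rho> (ECell e1 e2) (Cell v1 v2) (t1 + t2 + 1)"
| eval_Head: "eval P \<rho> e v t \<Longrightarrow> eval P \<rho> (EHead e) (head v) (t + 1)"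
| eval_Tail: "eval P \<rho> e v t \<Longrightarrow> eval P \<rho> (ETail e) (tail v) (t + 1)"
| eval_If_True: "\<lbrakk> eval P \<rho> e v t; v \<noteq> Null; eval P \<rho> e1 w s \<rbrakk>
    \<Longrightarrow> eval P \<rho> (EIf e e1 e2) w (t + s + 1)"
| eval_If_False: "\<lbrakk> eval P \<rho> e v t; v = Null; eval P \<rho> e2 w s \<rbrakk>
    \<Longrightarrow> eval P \<rho> (EIf e e1 e2) w (t + s + 1)"
| eval_Call: "\<lbrakk> f < length P; evals P \<rho> es vs t; eval P vs (P ! f) w s \<rbrakk>
    \<Longrightarrow> eval P \<rho> (ECall f es) w (t + s + 1)"
| evals_Nil: "evals P \<rho> [] [] 0"
| evals_Cons: "\<lbrakk> eval P \<rho> e v t; evals P \<rho> es vs s \<rbrakk>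
    \<Longrightarrow> evals P \<rho> (e # es) (v # vs) (t + s)"

inductive_cases eval_elims:
  "eval P \<rho> (EArg i) w u" "eval P \<rho> ENull w u" "eval P \<rho> (ECell e1 e2) w u"
  "eval P \<rho> (EHead e) w u" "eval P \<rho> (ETail e) w u" "eval P \<rho> (EIf e e1 e2) w u"
  "eval P \<rho> (ECall f es) w u" "evals P \<rho> [] ws u" "evals P \<rho> (e # es) ws u"

lemma eval_deterministic:
  "eval P \<rho> e v t \<Longrightarrow> eval P \<rho> e v' t' \<Longrightarrow> v' = v \<and> t' = t"
  "evals P \<rho> es vs t \<Longrightarrow> evals P \<rho> es vs' t' \<Longrightarrow> vs' = vs \<and> t' = t"
proof (induction arbitrary: v' t' and vs' t' rule: eval_evals.inducts)
  case eval_Arg then show ?case by (elim eval_elims) simp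
next
  case eval_Null then show ?case by (elim eval_elims) simp
next
  case eval_Cell from eval_Cell.prems show ?case
    by (rule eval_elims(3)) (metis eval_Cell.IH Suc_eq_plus1)
next
  case eval_Head from eval_Head.prems show ?case
    by (rule eval_elims(4)) (metis eval_Head.IH Suc_eq_plus1)
next
  case eval_Tail from eval_Tail.prems show ?case
    by (rule eval_elims(5)) (metis eval_Tail.IH Suc_eq_plus1)
next
  case eval_If_True from eval_If_True.prems show ?case
    by (rule eval_elims(6)) (metis eval_If_True.IH eval_If_True.hyps Suc_eq_plus1)+
next
  case eval_If_False from eval_If_False.prems show ?case
    by (rule eval_elims(6)) (metis eval_If_False.IH eval_If_False.hyps Suc_eq_plus1)+
next
  case eval_Call from eval_Call.prems show ?case
    by (rule eval_elims(7)) (metis eval_Call.IH Suc_eq_plus1)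
next
  case evals_Nil then show ?case by (elim eval_elims) simp
next
  case evals_Cons from evals_Cons.prems show ?case
    by (rule eval_elims(9)) (metis evals_Cons.IH)
qed

definition runs :: "program \<Rightarrow> data \<Rightarrow> data \<Rightarrow> nat \<Rightarrow> bool" where
  "runs P x y t \<longleftrightarrow> P \<noteq> [] \<and> eval P [x] (P ! 0) y t"

text \<open>The program halts on every input in \<open>D\<close> within polynomial time. As \<open>size\<close> counts the cells
  of a value as a tree, whereas the time measure allows subtrees to be shared, the size of
  the output is bounded explicitly: it is the time needed to write the output down.\<close>

definition polynomial_time_on :: "program \<Rightarrow> data set \<Rightarrow> bool" where
  "polynomial_time_on P D \<longleftrightarrow>
     (\<exists>p :: nat poly. \<forall>x\<in>D. \<exists>y t. runs P x y t \<and>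
        t \<le> poly p (size x) \<and> size y \<le> poly p (size x))"

section \<open>Representation of instances\<close>

text \<open>Vertices are natural numbers in binary, least significant bit first.\<close>

fun data_of_nat :: "nat \<Rightarrow> data" where
  "data_of_nat n =
     (if n = 0 then Null
      else Cell (if odd n then Cell Null Null else Null) (data_of_nat (n div 2)))"

declare data_of_nat.simps [simp del]

fun data_of_list :: "data list \<Rightarrow> data" where
  "data_of_list [] = Null"
| "data_of_list (x # xs) = Cell x (data_of_list xs)"

definition data_of_edge :: "nat \<times> nat \<Rightarrow> data" where
  "data_of_edge e = Cell (data_of_nat (fst e)) (data_of_nat (snd e))"

text \<open>An instance is presented by duplicate-free lists, in any order, of its vertices, its edges
  (with the endpoints of each edge in either order) and its non-terminals.\<close>

definition represents :: "data \<Rightarrow> nat set \<Rightarrow> nat set set \<Rightarrow> nat set \<Rightarrow> bool" where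
  "represents x V E N \<longleftrightarrow>
     (\<exists>vs es ns.
        distinct vs \<and> set vs = V \<and>
        distinct (map (\<lambda>(u, v). {u, v}) es) \<and> set (map (\<lambda>(u, v). {u, v}) es) = E \<and>
        distinct ns \<and> set ns = N \<and>
        x = Cell (data_of_list (map data_of_nat vs))
              (Cell (data_of_list (map data_of_edge es))
                 (data_of_list (map data_of_nat ns))))"

end

(* The kernel repeatedly suppresses a vertex b of degree 2 whose neighbours a and c are
   nonadjacent and of degree 2, when the membership of the nearby vertices in V_NT makes this
   safe. Solutions are handled as acyclic edge sets giving degree at least 2 on V_NT, since every
   acyclic edge set of a connected graph extends to a spanning tree. Suppression does not increase
   the max leaf number.

   If no suppression applies, let T be a spanning tree with the maximum number k of leaves.
   Exchanging edges shows that a vertex whose T-ball of radius 2 consists of vertices of T-degree 2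
   has degree 2 in the graph. Six consecutive vertices of degree 2 always contain a suppressible
   one, so every vertex of T-degree 2 lies within bounded T-distance of a vertex of another
   T-degree. As the degrees of the latter sum to at most 4k, the graph has at most 38k vertices. *)

theory Submission
  imports Defs
begin

section \<open>Acyclic edge sets and spanning trees\<close>

text \<open>The output must again leave two vertices outside \<open>N\<close>, so a vertex outside
  \<open>N\<close> may be suppressed only while three remain. This does not stall the reduction: the
  rule fails at a vertex of \<open>N\<close> only if both its neighbours are outside
  \<open>N\<close>, so six consecutive vertices of degree 2 without a suppressible one would by
  themselves contain three vertices outside \<open>N\<close>; and once three exist, the membership
  conditions at the four inner vertices contradict each other. The exchange works because an extra
  edge at the centre of a ball closes a cycle with the tree. The cycle leaves the ball on one side,
  and dropping the outer edge of the ball there gains a leaf. A run of ten vertices of T-degree 2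
  loses two at each end to the radius, which leaves six. Hence walks that start at the other
  vertices and never turn back reach every vertex of T-degree 2 within nine steps. Such walks do not
  branch, so each of nine layers is bounded by the at most \<open>4k\<close> first steps:
  \<open>36k\<close>, plus \<open>2k\<close> for the other vertices. The bound is linear in the max
  leaf number; the quadratic claim follows.\<close>

definition adj :: "'a set set \<Rightarrow> ('a \<times> 'a) set" where
  "adj E = {(x, y). {x, y} \<in> E}"

lemma adj_iff [simp]: "(x, y) \<in> adj E \<longleftrightarrow> {x, y} \<in> E"
  by (simp add: adj_def)

lemma connected_graph_iff:
  "connected_graph V E \<longleftrightarrow> V \<noteq> {} \<and> (\<forall>u\<in>V. \<forall>v\<in>V. (u, v) \<in> (adj E)\<^sup>*)"
  by (simp add: connected_graph_def adj_def)

text \<open>Every edge is a bridge. Stated through reachability, so that exchanges of edges need no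
  explicit cycles; a singleton edge is excluded because reachability is reflexive.\<close>

definition acyc :: "'a set set \<Rightarrow> bool" where
  "acyc F \<longleftrightarrow> (\<forall>u v. {u, v} \<in> F \<longrightarrow> (u, v) \<notin> (adj (F - {{u, v}}))\<^sup>*)"

lemma adj_rtrancl_sym: "(u, v) \<in> (adj E)\<^sup>* \<Longrightarrow> (v, u) \<in> (adj E)\<^sup>*"
proof -
  have "sym (adj E)" by (auto simp: sym_def insert_commute)
  then show "(u, v) \<in> (adj E)\<^sup>* \<Longrightarrow> (v, u) \<in> (adj E)\<^sup>*"
    by (meson sym_rtrancl symD)
qed

lemma adj_mono: "E \<subseteq> F \<Longrightarrow> (u, v) \<in> (adj E)\<^sup>* \<Longrightarrow> (u, v) \<in> (adj F)\<^sup>*"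
  using rtrancl_mono[of "adj E" "adj F"] by (auto simp: adj_def)

lemma adj_rtrancl_transfer:
  assumes "\<And>x y. {x, y} \<in> E \<Longrightarrow> (x, y) \<in> (adj F)\<^sup>*" and "(u, v) \<in> (adj E)\<^sup>*"
  shows "(u, v) \<in> (adj F)\<^sup>*"
  using assms(2) by induction (auto dest: assms(1) intro: rtrancl_trans)

text \<open>One crossing of the new edge suffices: a walk that comes back to an end of it can be
  shortened.\<close>

lemma reach_insert:
  assumes "(x, y) \<in> (adj (insert {u, v} F))\<^sup>*"
  shows "(x, y) \<in> (adj F)\<^sup>* \<or> (x, u) \<in> (adj F)\<^sup>* \<and> (v, y) \<in> (adj F)\<^sup>*
    \<or> (x, v) \<in> (adj F)\<^sup>* \<and> (u, y) \<in> (adj F)\<^sup>*"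
  using assms
proof induction
  case base then show ?case by simp
next
  case (step y z)
  show ?case
  proof (cases "{y, z} \<in> F")
    case True
    then have "\<And>w. (w, y) \<in> (adj F)\<^sup>* \<Longrightarrow> (w, z) \<in> (adj F)\<^sup>*"
      by (auto intro: rtrancl_into_rtrancl)
    with step.IH show ?thesis by blast
  next
    case False
    with step.hyps have "y = u \<and> z = v \<or> y = v \<and> z = u"
      by (auto simp: doubleton_eq_iff)
    with step.IH show ?thesis by auto
  qed
qed

text \<open>If an old edge \<open>{x, y}\<close> stopped being a bridge, its bypass would use the
  new edge; the rest of the bypass, closed up by \<open>{x, y}\<close>, would join \<open>u\<close>
  to \<open>v\<close> inside \<open>F\<close>.\<close>

lemma acyc_insert:
  assumes "acyc F" "(u, v) \<notin> (adj F)\<^sup>*"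
  shows "acyc (insert {u, v} F)"
  unfolding acyc_def
proof (intro allI impI notI)
  fix x y
  assume e: "{x, y} \<in> insert {u, v} F"
    and r: "(x, y) \<in> (adj (insert {u, v} F - {{x, y}}))\<^sup>*"
  show False
  proof (cases "{x, y} = {u, v}")
    case True
    have "(x, y) \<in> (adj F)\<^sup>*" by (rule adj_mono[OF _ r]) (use True in auto)
    with adj_rtrancl_sym[OF this] show False
      using True assms(2) by (auto simp: doubleton_eq_iff)
  next
    case False
    let ?G = "F - {{x, y}}"
    have xy: "{x, y} \<in> F" using e False by simp
    have "(x, y) \<notin> (adj ?G)\<^sup>*" using assms(1) xy by (auto simp: acyc_def)
    moreover have "insert {u, v} F - {{x, y}} = insert {u, v} ?G" using False by auto
    ultimately have d: "(x, u) \<in> (adj ?G)\<^sup>* \<and> (v, y) \<in> (adj ?G)\<^sup>*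
        \<or> (x, v) \<in> (adj ?G)\<^sup>* \<and> (u, y) \<in> (adj ?G)\<^sup>*"
      using reach_insert r by metis
    have up: "\<And>p q. (p, q) \<in> (adj ?G)\<^sup>* \<Longrightarrow> (p, q) \<in> (adj F)\<^sup>*"
      by (erule adj_mono[rotated]) auto
    have st: "(x, y) \<in> (adj F)\<^sup>*" using xy by auto
    have "(u, v) \<in> (adj F)\<^sup>*"
      using d
    proof (elim disjE conjE)
      assume "(x, u) \<in> (adj ?G)\<^sup>*" "(v, y) \<in> (adj ?G)\<^sup>*"
      note this[THEN up, THEN adj_rtrancl_sym]
      then show ?thesis using st by (meson rtrancl_trans)
    next
      assume "(x, v) \<in> (adj ?G)\<^sup>*" "(u, y) \<in> (adj ?G)\<^sup>*"
      note this[THEN up]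
      then show ?thesis using adj_rtrancl_sym[OF st] by (meson rtrancl_trans)
    qed
    then show False using assms(2) by simp
  qed
qed

lemma acyc_subset: "acyc F \<Longrightarrow> G \<subseteq> F \<Longrightarrow> acyc G"
  unfolding acyc_def
  by (meson Diff_mono adj_mono subsetD subset_refl)

text \<open>Such a walk, continued along \<open>{b, c}\<close>, would bypass
  \<open>{a, b}\<close>.\<close>

lemma acyc_not_reach_via:
  assumes "acyc F" "{a, b} \<in> F" "{b, c} \<in> F" "a \<noteq> c"
  shows "(a, c) \<notin> (adj (F - {{a, b}, {b, c}}))\<^sup>*"
proof
  assume "(a, c) \<in> (adj (F - {{a, b}, {b, c}}))\<^sup>*"
  then have "(a, c) \<in> (adj (F - {{a, b}}))\<^sup>*" by (rule adj_mono[rotated]) auto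
  moreover have "(c, b) \<in> adj (F - {{a, b}})"
    using assms(3,4) by (auto simp: insert_commute doubleton_eq_iff)
  ultimately have "(a, b) \<in> (adj (F - {{a, b}}))\<^sup>*" by (rule rtrancl_into_rtrancl)
  then show False using assms(1,2) by (auto simp: acyc_def)
qed

lemma reach_isolated:
  assumes "\<And>e. e \<in> F \<Longrightarrow> b \<notin> e" "(u, b) \<in> (adj F)\<^sup>*"
  shows "u = b"
  using assms(2) by (rule rtranclE) (auto dest: assms(1))

lemma acyc_pendant:
  assumes "acyc F" "\<And>e. e \<in> F \<Longrightarrow> b \<notin> e" "a \<noteq> b"
  shows "acyc (insert {a, b} F)"
  using assms(3) reach_isolated[OF assms(2)] by (intro acyc_insert[OF assms(1)]) blast

text \<open>Once \<open>{a, c}\<close> is deleted and \<open>b\<close> hangs on \<open>a\<close>, a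
  connection from \<open>b\<close> to \<open>c\<close> would yield one from \<open>a\<close> to
  \<open>c\<close> that bypasses the deleted edge.\<close>

lemma acyc_subdivide:
  assumes "acyc F" "{a, c} \<in> F" "\<And>e. e \<in> F \<Longrightarrow> b \<notin> e"
  shows "acyc (insert {b, c} (insert {a, b} (F - {{a, c}})))"
proof (rule acyc_insert)
  let ?G = "F - {{a, c}}"
  have ab: "a \<noteq> b" "c \<noteq> b" using assms(2,3) by auto
  show "acyc (insert {a, b} ?G)"
    by (rule acyc_pendant) (use assms ab in \<open>auto intro: acyc_subset\<close>)
  have nac: "(a, c) \<notin> (adj ?G)\<^sup>*" using assms(1,2) by (auto simp: acyc_def)
  show "(b, c) \<notin> (adj (insert {a, b} ?G))\<^sup>*"
  proof
    assume "(b, c) \<in> (adj (insert {a, b} ?G))\<^sup>*"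
    from reach_insert[OF this] have "(b, c) \<in> (adj ?G)\<^sup>* \<or> (a, c) \<in> (adj ?G)\<^sup>*
      \<or> (b, c) \<in> (adj ?G)\<^sup>*" by auto
    then have "(c, b) \<in> (adj ?G)\<^sup>*" using nac adj_rtrancl_sym by metis
    then have "c = b" by (rule reach_isolated[rotated]) (use assms in auto)
    then show False using ab by simp
  qed
qed

lemma acyc_suppress:
  assumes "acyc F" "{a, b} \<in> F" "{b, c} \<in> F" "a \<noteq> c"
  shows "acyc (insert {a, c} (F - {{a, b}, {b, c}}))"
  by (intro acyc_insert acyc_not_reach_via acyc_subset[OF assms(1)] assms) auto

text \<open>The closing edge from the last vertex to the first is bypassed by the rest of the
  cycle.\<close>

lemma cycle_imp_not_acyc:
  assumes "cycle_in F c" shows "\<not> acyc F"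
proof
  assume ac: "acyc F"
  define n where "n = length c"
  have n: "n \<ge> 3" and d: "distinct c"
    and e: "\<And>i. i < n \<Longrightarrow> {c ! i, c ! (Suc i mod n)} \<in> F"
    using assms by (auto simp: cycle_in_def n_def)
  let ?e = "{c ! 0, c ! (n - 1)}"
  have "(c ! 0, c ! i) \<in> (adj (F - {?e}))\<^sup>*" if "i < n" for i
    using that
  proof (induction i)
    case 0 then show ?case by simp
  next
    case (Suc i)
    have "{c ! i, c ! Suc i} \<in> F" using e[of i] Suc.prems by simp
    \<comment> \<open>Length at least 3 matters here: with two vertices the only path edge would be
      the closing edge.\<close>
    moreover have "{c ! i, c ! Suc i} \<noteq> ?e"
    proof -
      have "0 < length c" using n unfolding n_def by linarith
      then have "c ! i \<noteq> c ! (n - 1)" "c ! Suc i \<noteq> c ! 0"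
        using d n Suc.prems by (auto simp: nth_eq_iff_index_eq n_def)
      moreover have "c ! i \<noteq> c ! 0 \<or> c ! Suc i \<noteq> c ! (n - 1)"
        using d n Suc.prems \<open>0 < length c\<close> by (auto simp: nth_eq_iff_index_eq n_def)
      ultimately show ?thesis by (auto simp: doubleton_eq_iff)
    qed
    ultimately have "(c ! i, c ! Suc i) \<in> adj (F - {?e})" by simp
    then show ?case using Suc by (meson Suc_lessD rtrancl_into_rtrancl)
  qed
  from this[of "n - 1"] n have "(c ! 0, c ! (n - 1)) \<in> (adj (F - {?e}))\<^sup>*" by simp
  moreover have "?e \<in> F" using e[of "n - 1"] n by (simp add: insert_commute)
  ultimately show False using ac by (auto simp: acyc_def)
qed

text \<open>A shortest bypass of an edge that is not a bridge repeats no vertex, so the edge closes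
  it up to a cycle.\<close>

lemma not_acyc_imp_cycle:
  assumes "\<not> acyc F" "\<And>e. e \<in> F \<Longrightarrow> card e = 2"
  shows "\<exists>c. cycle_in F c"
proof -
  obtain u v where uv: "{u, v} \<in> F" and r: "(u, v) \<in> (adj (F - {{u, v}}))\<^sup>*"
    using assms(1) by (auto simp: acyc_def)
  let ?R = "adj (F - {{u, v}})"
  have "u \<noteq> v" using assms(2)[OF uv] by auto
  define n where "n = (LEAST n. (u, v) \<in> ?R ^^ n)"
  obtain m where "(u, v) \<in> ?R ^^ m" using r rtrancl_imp_relpow by metis
  then have "(u, v) \<in> ?R ^^ n" unfolding n_def by (rule LeastI)
  then obtain f where f: "f 0 = u" "f n = v" "\<And>i. i < n \<Longrightarrow> (f i, f (Suc i)) \<in> ?R"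
    unfolding relpow_fun_conv by auto
  have short: "n \<le> m" if "(u, v) \<in> ?R ^^ m" for m
    unfolding n_def using that by (rule Least_le)
  have inj: "f i \<noteq> f j" if "i < j" "j \<le> n" for i j
  proof
    assume eq: "f i = f j"
    \<comment> \<open>\<open>g\<close> skips the piece of the walk between the two equal
      vertices.\<close>
    define g where "g = (\<lambda>k. if k \<le> i then f k else f (k + (j - i)))"
    have "(g k, g (Suc k)) \<in> ?R" if "k < n - (j - i)" for k
    proof -
      consider "Suc k \<le> i" | "k = i" | "i < k" by linarith
      then show ?thesis
      proof cases
        case 1
        then have "g k = f k" "g (Suc k) = f (Suc k)" "k < n" unfolding g_def using \<open>i < j\<close> \<open>j \<le> n\<close> by auto
        then show ?thesis using f(3)[of k] by (simp only:)
      next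
        case 2
        then have "g k = f j" "g (Suc k) = f (Suc j)" "j < n"
          unfolding g_def using eq \<open>i < j\<close> that by auto
        then show ?thesis using f(3)[of j] by (simp only:)
      next
        case 3
        then have "g k = f (k + (j - i))" "g (Suc k) = f (Suc (k + (j - i)))"
          "k + (j - i) < n" unfolding g_def using that by auto
        then show ?thesis using f(3)[of "k + (j - i)"] by (simp only:)
      qed
    qed
    moreover have "g 0 = u" unfolding g_def using f by simp
    moreover have "g (n - (j - i)) = v"
    proof (cases "j = n")
      case True then show ?thesis unfolding g_def using eq f \<open>i < j\<close> by simp
    next
      case False then show ?thesis unfolding g_def using f that by simp
    qed
    ultimately have "(u, v) \<in> ?R ^^ (n - (j - i))"
      unfolding relpow_fun_conv by (intro exI[of _ g]) simp
    from short[OF this] show False using that by simp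
  qed
  \<comment> \<open>A bypass of length 1 would be the deleted edge itself.\<close>
  have n2: "n \<ge> 2"
  proof (rule ccontr)
    assume "\<not> n \<ge> 2"
    then have "n = 0 \<or> n = 1" by auto
    then show False using f \<open>u \<noteq> v\<close> f(3)[of 0] by auto
  qed
  have "cycle_in F (map f [0..<Suc n])"
    unfolding cycle_in_def
  proof (intro conjI allI impI)
    show "3 \<le> length (map f [0..<Suc n])" using n2 by simp
    have "inj_on f {0..<Suc n}"
      using inj by (intro linorder_inj_onI) auto
    then show "distinct (map f [0..<Suc n])" by (simp add: distinct_map del: upt_Suc)
    fix i assume "i < length (map f [0..<Suc n])"
    then consider "i < n" | "i = n" by fastforce
    then show "{map f [0..<Suc n] ! i, map f [0..<Suc n] !
        (Suc i mod length (map f [0..<Suc n]))} \<in> F"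
    proof cases
      case 1
      then show ?thesis using f(3)[of i] by (simp add: nth_map_upt del: upt_Suc)
    next
      case 2
      then show ?thesis using f uv by (simp add: nth_map_upt insert_commute del: upt_Suc)
    qed
  qed
  then show ?thesis by blast
qed

section \<open>Spanning trees as connected acyclic edge sets\<close>

lemma tree_graph_iff:
  "tree_graph V T \<longleftrightarrow> simple_graph V T \<and> connected_graph V T \<and> acyc T"
proof -
  have "(\<nexists>c. cycle_in T c) \<longleftrightarrow> acyc T" if "simple_graph V T"
    using that not_acyc_imp_cycle[of T] cycle_imp_not_acyc[of T]
    unfolding simple_graph_def by blast
  then show ?thesis unfolding tree_graph_def by blast
qed

text \<open>After an exchange, only the removed edges need a genuine replacement walk.\<close>

lemma connected_transfer:
  assumes "connected_graph V H" "\<And>x y. {x, y} \<in> H \<Longrightarrow> (x, y) \<in> (adj H')\<^sup>*"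
  shows "connected_graph V H'"
  using assms adj_rtrancl_transfer[of H H'] unfolding connected_graph_iff by blast

lemma simple_graph_finite: "simple_graph V E \<Longrightarrow> finite E"
  by (rule finite_subset[of _ "Pow V"]) (auto simp: simple_graph_def)

lemma simple_graph_subset: "simple_graph V E \<Longrightarrow> F \<subseteq> E \<Longrightarrow> simple_graph V F"
  unfolding simple_graph_def by blast

lemma simple_graph_edge:
  assumes "simple_graph V E" "{u, v} \<in> E"
  shows "u \<in> V" "v \<in> V" "u \<noteq> v"
proof -
  have "card {u, v} = 2" "{u, v} \<subseteq> V" using assms by (auto simp: simple_graph_def)
  then show "u \<in> V" "v \<in> V" "u \<noteq> v" by auto
qed

lemma simple_graph_edgeE:
  assumes "simple_graph V E" "e \<in> E"
  obtains u v where "e = {u, v}" "u \<noteq> v" "u \<in> V" "v \<in> V"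
proof -
  have "card e = 2" "e \<subseteq> V" using assms by (auto simp: simple_graph_def)
  then show thesis using that by (auto simp: card_2_iff)
qed

text \<open>Deleting an edge that is not a bridge keeps the graph connected; this is repeated until
  all edges are bridges.\<close>

lemma connected_contains_acyc:
  assumes "finite H" "connected_graph V H"
  shows "\<exists>T\<subseteq>H. connected_graph V T \<and> acyc T"
  using assms
proof (induction H rule: finite_psubset_induct)
  case (psubset H)
  show ?case
  proof (cases "acyc H")
    case False
    then obtain u v where uv: "{u, v} \<in> H" "(u, v) \<in> (adj (H - {{u, v}}))\<^sup>*"
      by (auto simp: acyc_def)
    have "connected_graph V (H - {{u, v}})"
    proof (rule connected_transfer[OF psubset.prems])
      fix x y assume "{x, y} \<in> H"
      then show "(x, y) \<in> (adj (H - {{u, v}}))\<^sup>*"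
        using uv(2) adj_rtrancl_sym[OF uv(2)]
        by (cases "{x, y} = {u, v}") (auto simp: doubleton_eq_iff)
    qed
    with psubset.IH[of "H - {{u, v}}"] uv(1) show ?thesis by blast
  qed (use psubset in auto)
qed

text \<open>A maximal acyclic superset of \<open>F\<close> is connected, since an edge of
  \<open>E\<close> between two of its components could still be added.\<close>

lemma acyc_extends_to_spanning_tree:
  assumes "simple_graph V E" "connected_graph V E" "F \<subseteq> E" "acyc F"
  shows "\<exists>T. F \<subseteq> T \<and> spanning_tree V E T"
proof -
  define A where "A = {T. F \<subseteq> T \<and> T \<subseteq> E \<and> acyc T}"
  have "finite A"
    by (rule finite_subset[of _ "Pow E"]) (use assms simple_graph_finite in \<open>auto simp: A_def\<close>)
  moreover have "A \<noteq> {}" using assms by (auto simp: A_def)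
  ultimately obtain T where "T \<in> A" and m: "\<forall>S\<in>A. T \<subseteq> S \<longrightarrow> T = S"
    using finite_has_maximal by metis
  then have T: "F \<subseteq> T" "T \<subseteq> E" "acyc T" by (auto simp: A_def)
  have max: "S = T" if "F \<subseteq> S" "S \<subseteq> E" "acyc S" "T \<subseteq> S" for S
    using m that by (auto simp: A_def)
  have "connected_graph V T"
  proof (rule connected_transfer[OF assms(2)], rule ccontr)
    fix x y assume xy: "{x, y} \<in> E" "(x, y) \<notin> (adj T)\<^sup>*"
    have "insert {x, y} T = T"
      by (rule max) (use T xy acyc_insert[OF T(3) xy(2)] in auto)
    then have "(x, y) \<in> adj T" by auto
    then show False using xy(2) by blast
  qed
  then show ?thesis using T simple_graph_subset[OF assms(1) T(2)]
    unfolding spanning_tree_def tree_graph_iff by (intro exI[of _ T]) simp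
qed

lemma vdegree_mono: "finite F \<Longrightarrow> G \<subseteq> F \<Longrightarrow> vdegree G v \<le> vdegree F v"
  unfolding vdegree_def by (rule card_mono) auto

lemma ntst_yes_iff_acyc:
  assumes "simple_graph V E" "connected_graph V E"
  shows "ntst_yes V E N \<longleftrightarrow> (\<exists>F\<subseteq>E. acyc F \<and> (\<forall>v\<in>N. vdegree F v \<ge> 2))"
proof
  assume "ntst_yes V E N"
  then show "\<exists>F\<subseteq>E. acyc F \<and> (\<forall>v\<in>N. vdegree F v \<ge> 2)"
    unfolding ntst_yes_def spanning_tree_def tree_graph_iff by blast
next
  assume "\<exists>F\<subseteq>E. acyc F \<and> (\<forall>v\<in>N. vdegree F v \<ge> 2)"
  then obtain F where F: "F \<subseteq> E" "acyc F" "\<And>v. v \<in> N \<Longrightarrow> vdegree F v \<ge> 2" by blast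
  obtain T where T: "F \<subseteq> T" "spanning_tree V E T"
    using acyc_extends_to_spanning_tree[OF assms F(1,2)] by blast
  have "finite T" using T(2) assms(1) simple_graph_finite
    by (auto simp: spanning_tree_def intro: finite_subset)
  then show "ntst_yes V E N"
    unfolding ntst_yes_def using T F(3) vdegree_mono[OF _ T(1)] by (meson order_trans)
qed

section \<open>Neighbourhoods, degrees and leaf counts\<close>

definition nb :: "'a set set \<Rightarrow> 'a \<Rightarrow> 'a set" where
  "nb E v = {u. {u, v} \<in> E}"

lemma nb_sym: "u \<in> nb E v \<longleftrightarrow> v \<in> nb E u"
  by (simp add: nb_def insert_commute)

lemma vdegree_nb:
  assumes "simple_graph V E"
  shows "vdegree E v = card (nb E v)"
proof -
  have "{e \<in> E. v \<in> e} = (\<lambda>u. {u, v}) ` nb E v"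
  proof (intro equalityI subsetI)
    fix e assume e: "e \<in> {e \<in> E. v \<in> e}"
    then obtain x y where "e = {x, y}" using assms simple_graph_edgeE by blast
    then show "e \<in> (\<lambda>u. {u, v}) ` nb E v" using e by (auto simp: nb_def insert_commute)
  qed (auto simp: nb_def)
  moreover have "inj_on (\<lambda>u. {u, v}) (nb E v)"
    by (auto simp: inj_on_def doubleton_eq_iff)
  ultimately show ?thesis by (simp add: vdegree_def card_image)
qed

lemma nb_finite: "simple_graph V E \<Longrightarrow> finite (nb E v)"
  by (rule finite_subset[of _ V]) (auto simp: nb_def simple_graph_def)

lemma nb_nonempty:
  assumes "connected_graph V E" "card V \<ge> 2" "v \<in> V"
  shows "nb E v \<noteq> {}"
proof -
  have "V \<noteq> {v}" using assms(2) by auto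
  then obtain u where "u \<in> V" "u \<noteq> v" using assms(3) by blast
  then have "(u, v) \<in> (adj E)\<^sup>*" using assms by (auto simp: connected_graph_iff)
  then show ?thesis using \<open>u \<noteq> v\<close> by (cases rule: rtranclE) (auto simp: nb_def)
qed

text \<open>Ranges over connected spanning subgraphs instead of trees, so that exchanges need only
  preserve connectivity. On at least two vertices, trees attain the same leaf counts by
  \<open>leafy_acyc\<close>.\<close>

definition leafy :: "'a set \<Rightarrow> 'a set set \<Rightarrow> nat \<Rightarrow> bool" where
  "leafy V E k \<longleftrightarrow> (\<exists>H\<subseteq>E. connected_graph V H \<and> k \<le> card (leaves V H))"

text \<open>A connected subgraph on at least two vertices isolates no vertex, so a vertex of degree
  1 keeps its only edge.\<close>

lemma leaves_antimono:
  assumes "simple_graph V H" "T \<subseteq> H" "connected_graph V T" "card V \<ge> 2"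
  shows "leaves V H \<subseteq> leaves V T"
proof
  fix v assume v: "v \<in> leaves V H"
  have "nb T v \<noteq> {}" using nb_nonempty[OF assms(3,4)] v by (simp add: leaves_def)
  moreover have "vdegree T v = card (nb T v)" "finite (nb T v)"
    using vdegree_nb nb_finite simple_graph_subset[OF assms(1,2)] by metis+
  ultimately have "vdegree T v > 0" by (simp add: card_gt_0_iff)
  moreover have "vdegree T v \<le> vdegree H v"
    using assms vdegree_mono simple_graph_finite by metis
  ultimately show "v \<in> leaves V T" using v by (auto simp: leaves_def)
qed

lemma leafy_acyc:
  assumes "simple_graph V E" "leafy V E k" "card V \<ge> 2"
  shows "\<exists>T\<subseteq>E. connected_graph V T \<and> acyc T \<and> k \<le> card (leaves V T)"
proof -
  obtain H where H: "H \<subseteq> E" "connected_graph V H" "k \<le> card (leaves V H)"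
    using assms by (auto simp: leafy_def)
  have sH: "simple_graph V H" using H assms simple_graph_subset by blast
  then obtain T where T: "T \<subseteq> H" "connected_graph V T" "acyc T"
    using connected_contains_acyc H simple_graph_finite by metis
  have "finite (leaves V T)" using assms by (auto simp: leaves_def simple_graph_def)
  then have "card (leaves V H) \<le> card (leaves V T)"
    using leaves_antimono[OF sH] T assms by (intro card_mono) auto
  then show ?thesis using T H by (intro exI[of _ T]) auto
qed

lemma leafy_le_max_leaf_number:
  assumes "simple_graph V E" "leafy V E k" "card V \<ge> 2"
  shows "k \<le> max_leaf_number V E"
proof -
  obtain T where T: "T \<subseteq> E" "connected_graph V T" "acyc T" "k \<le> card (leaves V T)"
    using leafy_acyc assms by metis
  then have "spanning_tree V E T"
    using assms simple_graph_subset by (auto simp: spanning_tree_def tree_graph_iff)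
  moreover have "finite {card (leaves V T) | T. spanning_tree V E T}"
    by (rule finite_subset[of _ "(\<lambda>T. card (leaves V T)) ` Pow E"])
      (use assms(1) simple_graph_finite in \<open>auto simp: spanning_tree_def\<close>)
  ultimately have "card (leaves V T) \<le> max_leaf_number V E"
    unfolding max_leaf_number_def by (intro Max_ge) auto
  then show ?thesis using T by simp
qed

section \<open>Suppressing a vertex of degree 2\<close>

lemma ntst_yes_iff:
  assumes "simple_graph V E" "connected_graph V E"
  shows "ntst_yes V E N \<longleftrightarrow> (\<exists>F\<subseteq>E. acyc F \<and> (\<forall>v\<in>N. card (nb F v) \<ge> 2))"
proof -
  have "vdegree F v = card (nb F v)" if "F \<subseteq> E" for F v
    using vdegree_nb simple_graph_subset[OF assms(1) that] by metis
  then show ?thesis unfolding ntst_yes_iff_acyc[OF assms] by auto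
qed

lemma nb_mono: "F \<subseteq> G \<Longrightarrow> nb F v \<subseteq> nb G v"
  by (auto simp: nb_def)

lemma connected_insert:
  assumes "connected_graph W H" "a \<in> W" "{a, b} \<in> H"
  shows "connected_graph (insert b W) H"
proof -
  have ab: "(a, b) \<in> (adj H)\<^sup>*" "(b, a) \<in> (adj H)\<^sup>*"
    using assms(3) by (auto simp: insert_commute)
  have W: "\<And>u v. u \<in> W \<Longrightarrow> v \<in> W \<Longrightarrow> (u, v) \<in> (adj H)\<^sup>*"
    using assms(1) by (simp add: connected_graph_iff)
  have "(u, v) \<in> (adj H)\<^sup>*" if "u \<in> insert b W" "v \<in> insert b W" for u v
  proof -
    have "(u, a) \<in> (adj H)\<^sup>*" "(a, v) \<in> (adj H)\<^sup>*"
      using that W ab assms(2) by auto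
    then show ?thesis by (rule rtrancl_trans)
  qed
  then show ?thesis by (simp add: connected_graph_iff)
qed

definition sup_edges :: "'a set set \<Rightarrow> 'a \<Rightarrow> 'a \<Rightarrow> 'a \<Rightarrow> 'a set set" where
  "sup_edges E a b c = insert {a, c} (E - {{a, b}, {b, c}})"

text \<open>A vertex outside \<open>N\<close> between two vertices of \<open>N\<close> of degree 2 is not a leaf of any solution,
  so it may be suppressed; but this uses up a vertex outside \<open>N\<close>, and two of them must remain.\<close>

definition reducible :: "'a set \<Rightarrow> 'a set set \<Rightarrow> 'a set \<Rightarrow> 'a \<Rightarrow> 'a \<Rightarrow> 'a \<Rightarrow> bool" where
  "reducible V E N a b c \<longleftrightarrow>
     nb E b = {a, c} \<and> a \<noteq> c \<and> {a, c} \<notin> E \<and> card (nb E a) = 2 \<and> card (nb E c) = 2 \<and>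
     (if b \<in> N then a \<in> N \<or> c \<in> N \<or> \<not> nb E a \<subseteq> N \<or> \<not> nb E c \<subseteq> N
      else (a \<in> N \<longleftrightarrow> c \<in> N) \<and> 3 \<le> card (V - N))"

text \<open>Nonadjacency of \<open>a\<close> and \<open>c\<close> makes the new edge really new:
  otherwise it would coincide with an old one, and \<open>a\<close> and \<open>c\<close> would lose
  degree.\<close>

locale suppression =
  fixes V :: "'a set" and E a b c
  assumes sg: "simple_graph V E" and cg: "connected_graph V E"
    and nbb: "nb E b = {a, c}" and ac: "a \<noteq> c" and nac: "{a, c} \<notin> E"
begin

abbreviation "E' \<equiv> sup_edges E a b c"
abbreviation "V' \<equiv> V - {b}"

lemma ab: "{a, b} \<in> E" and bc: "{b, c} \<in> E"
  using nbb by (auto simp: nb_def insert_commute)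

lemma in_V: "a \<in> V" "b \<in> V" "c \<in> V" and ab_neq: "a \<noteq> b" "b \<noteq> c"
  using simple_graph_edge[OF sg ab] simple_graph_edge[OF sg bc] by auto

lemma edges_at_b: "e \<in> E \<Longrightarrow> b \<in> e \<Longrightarrow> e = {a, b} \<or> e = {b, c}"
proof -
  assume e: "e \<in> E" "b \<in> e"
  then obtain u where u: "e = {u, b}" using sg by (auto elim!: simple_graph_edgeE)
  then have "u \<in> nb E b" using e by (simp add: nb_def)
  then show ?thesis using nbb u by (auto simp: insert_commute)
qed

lemma b_notin_sup: "e \<in> E' \<Longrightarrow> b \<notin> e"
  using edges_at_b ab_neq by (auto simp: sup_edges_def)

lemma simple_sup: "simple_graph V' E'"
  unfolding simple_graph_def
proof (intro conjI ballI)
  show "finite V'" using sg by (simp add: simple_graph_def)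
  fix e assume e: "e \<in> E'"
  then have "e = {a, c} \<or> e \<in> E" by (auto simp: sup_edges_def)
  then have "e \<subseteq> V \<and> card e = 2" using sg ac in_V by (auto simp: simple_graph_def)
  then show "e \<subseteq> V'" "card e = 2" using b_notin_sup[OF e] by auto
qed

text \<open>\<open>a\<close> trades its neighbour \<open>b\<close> for \<open>c\<close>, and
  \<open>c\<close> trades \<open>b\<close> for \<open>a\<close>; both new neighbours are really new
  because \<open>{a, c}\<close> is not in \<open>F\<close>.\<close>

lemma nb_sup:
  assumes "F \<subseteq> E" "v \<noteq> b" "{a, b} \<in> F" "{b, c} \<in> F"
  shows "card (nb (sup_edges F a b c) v) = card (nb F v)"
proof -
  have fin: "finite (nb F u)" for u
    by (rule nb_finite[OF simple_graph_subset[OF sg assms(1)]])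
  have nF: "{a, c} \<notin> F" using nac assms(1) by blast
  consider "v = a" | "v = c" | "v \<noteq> a" "v \<noteq> c" by blast
  then show ?thesis
  proof cases
    case 1
    have "nb (sup_edges F a b c) v = insert c (nb F v - {b})"
      using 1 ac ab_neq assms by (auto simp: nb_def sup_edges_def doubleton_eq_iff)
    moreover have "c \<notin> nb F v" "b \<in> nb F v"
      using 1 nF assms by (auto simp: nb_def insert_commute)
    ultimately show ?thesis using fin[of v]
      by (metis Diff_iff card.remove card_insert_disjoint finite_Diff)
  next
    case 2
    have "nb (sup_edges F a b c) v = insert a (nb F v - {b})"
      using 2 ac ab_neq assms by (auto simp: nb_def sup_edges_def doubleton_eq_iff)
    moreover have "a \<notin> nb F v" "b \<in> nb F v"
      using 2 nF assms by (auto simp: nb_def insert_commute)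
    ultimately show ?thesis using fin[of v]
      by (metis Diff_iff card.remove card_insert_disjoint finite_Diff)
  next
    case 3
    have "nb (sup_edges F a b c) v = nb F v"
      using 3 assms by (auto simp: nb_def sup_edges_def doubleton_eq_iff)
    then show ?thesis by simp
  qed
qed

text \<open>Inverse of \<open>sup_edges\<close> on edge sets that contain
  \<open>{a, c}\<close>.\<close>

definition unsup :: "'a set set \<Rightarrow> 'a set set" where
  "unsup F = insert {b, c} (insert {a, b} (F - {{a, c}}))"

lemma unsup_subset: "F \<subseteq> E' \<Longrightarrow> unsup F \<subseteq> E"
  using ab bc by (auto simp: unsup_def sup_edges_def)

lemma sup_unsup:
  assumes "F \<subseteq> E'" "{a, c} \<in> F"
  shows "sup_edges (unsup F) a b c = F"
proof -
  have "{a, b} \<notin> F" "{b, c} \<notin> F" using assms(1) b_notin_sup by blast+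
  moreover have "{a, b} \<noteq> {a, c}" "{b, c} \<noteq> {a, c}" using ab_neq ac by (auto simp: doubleton_eq_iff)
  ultimately show ?thesis using assms(2) by (auto simp: sup_edges_def unsup_def)
qed

lemma nb_unsup:
  assumes "F \<subseteq> E'" "{a, c} \<in> F" "v \<noteq> b"
  shows "card (nb (unsup F) v) = card (nb F v)"
  using nb_sup[OF unsup_subset[OF assms(1)] assms(3)] sup_unsup[OF assms(1,2)]
  by (simp add: unsup_def)

lemma nb_b_card: "{a, b} \<in> F \<Longrightarrow> {b, c} \<in> F \<Longrightarrow> F \<subseteq> E \<Longrightarrow> card (nb F b) = 2"
proof -
  assume F: "{a, b} \<in> F" "{b, c} \<in> F" "F \<subseteq> E"
  have "nb F b = {a, c}" using nb_mono[OF F(3), of b] nbb F(1,2)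
    by (auto simp: nb_def insert_commute)
  then show ?thesis using ac by simp
qed

lemma connected_sup: "connected_graph V' E'"
proof -
  \<comment> \<open>Contracting \<open>b\<close> into \<open>a\<close> turns every edge of
    \<open>E\<close> into a walk of \<open>E'\<close>: \<open>{a, b}\<close> becomes trivial and
    \<open>{b, c}\<close> becomes the new edge.\<close>
  define f where "f = (\<lambda>v. if v = b then a else v)"
  have st: "(f x, f y) \<in> (adj E')\<^sup>*" if xy: "{x, y} \<in> E" for x y
  proof -
    consider "{x, y} = {a, b}" | "{x, y} = {b, c}" | "b \<notin> {x, y}"
      using edges_at_b[OF xy] by blast
    then show ?thesis
    proof cases
      case 1
      then show ?thesis by (auto simp: f_def doubleton_eq_iff)
    next
      case 2
      have "(a, c) \<in> adj E'" "(c, a) \<in> adj E'" by (auto simp: sup_edges_def insert_commute)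
      then show ?thesis using 2 ab_neq by (auto simp: f_def doubleton_eq_iff)
    next
      case 3
      then have "{x, y} \<in> E'" using xy by (auto simp: sup_edges_def)
      then have "(x, y) \<in> adj E'" by simp
      then show ?thesis using 3 by (auto simp: f_def)
    qed
  qed
  have "(f u, f v) \<in> (adj E')\<^sup>*" if "(u, v) \<in> (adj E)\<^sup>*" for u v
    using that by induction (auto intro: rtrancl_trans st)
  moreover have "\<And>v. v \<in> V' \<Longrightarrow> f v = v" by (simp add: f_def)
  ultimately show ?thesis using cg in_V ab_neq unfolding connected_graph_iff
    by (metis DiffD1 DiffI empty_iff singletonD)
qed

text \<open>A subgraph with \<open>{a, c}\<close> is lifted by subdividing this edge, which keeps
  the other degrees. Otherwise \<open>b\<close> is hung on \<open>a\<close>, and the new leaf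
  \<open>b\<close> makes up for \<open>a\<close>, the only vertex that may cease to be a
  leaf.\<close>

lemma leafy_sup:
  assumes "leafy V' E' k" shows "leafy V E k"
proof -
  obtain H where H: "H \<subseteq> E'" "connected_graph V' H" "k \<le> card (leaves V' H)"
    using assms by (auto simp: leafy_def)
  have finV: "finite V" using sg by (simp add: simple_graph_def)
  have sH: "simple_graph V' H" using simple_graph_subset simple_sup H by blast
  have VV: "insert b V' = V" using in_V by auto
  have aV: "a \<in> V'" using in_V ab_neq by auto
  show ?thesis
  proof (cases "{a, c} \<in> H")
    case True
    let ?H = "unsup H"
    have sub: "?H \<subseteq> E" using unsup_subset H by blast
    have "(a, b) \<in> adj ?H" "(b, c) \<in> adj ?H" by (auto simp: unsup_def)
    then have r: "(a, c) \<in> (adj ?H)\<^sup>*" by (meson r_into_rtrancl rtrancl_trans)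
    have "connected_graph V' ?H"
    proof (rule connected_transfer[OF H(2)])
      fix x y assume "{x, y} \<in> H"
      show "(x, y) \<in> (adj ?H)\<^sup>*"
      proof (cases "{x, y} = {a, c}")
        case True then show ?thesis using r adj_rtrancl_sym[OF r] by (auto simp: doubleton_eq_iff)
      next
        case False
        then have "(x, y) \<in> adj ?H" using \<open>{x, y} \<in> H\<close> by (simp add: unsup_def)
        then show ?thesis by blast
      qed
    qed
    then have "connected_graph V ?H"
      using connected_insert[of V' ?H a b] aV VV by (simp add: unsup_def)
    moreover have "leaves V' H \<subseteq> leaves V ?H"
      using nb_unsup[OF H(1) True] vdegree_nb[OF sH] vdegree_nb[OF simple_graph_subset[OF sg sub]]
      by (auto simp: leaves_def)
    then have "card (leaves V' H) \<le> card (leaves V ?H)"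
      by (rule card_mono[rotated]) (use finV in \<open>simp add: leaves_def\<close>)
    ultimately show ?thesis using H sub unfolding leafy_def by (intro exI[of _ ?H]) auto
  next
    case False
    let ?H = "insert {a, b} H"
    have sub: "?H \<subseteq> E" using False H(1) ab by (auto simp: sup_edges_def)
    have "connected_graph V' ?H"
      by (rule connected_transfer[OF H(2)]) (simp add: r_into_rtrancl)
    then have "connected_graph V ?H"
      using connected_insert[of V' ?H a b] aV VV by simp
    moreover have "card (leaves V' H) \<le> card (leaves V ?H)"
    proof -
      have deg: "{e \<in> ?H. v \<in> e} = {e \<in> H. v \<in> e}" if "v \<noteq> a" "v \<noteq> b" for v
        using that by auto
      have "vdegree ?H v = vdegree H v" if "v \<noteq> a" "v \<noteq> b" for v
        unfolding vdegree_def deg[OF that] ..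
      moreover have "{e \<in> ?H. b \<in> e} = {{a, b}}" using b_notin_sup H(1) by auto
      then have "vdegree ?H b = 1" by (simp add: vdegree_def)
      ultimately have "insert b (leaves V' H - {a}) \<subseteq> leaves V ?H"
        using in_V by (auto simp: leaves_def)
      then have "card (insert b (leaves V' H - {a})) \<le> card (leaves V ?H)"
        by (rule card_mono[rotated]) (use finV in \<open>simp add: leaves_def\<close>)
      moreover have "finite (leaves V' H)" "b \<notin> leaves V' H"
        using finV by (auto simp: leaves_def)
      ultimately show ?thesis by (cases "a \<in> leaves V' H") (simp_all add: card_Suc_Diff1)
    qed
    ultimately show ?thesis using H sub unfolding leafy_def by (intro exI[of _ ?H]) auto
  qed
qed

section \<open>Equivalence of the instances before and after suppression\<close>

lemma nb_sup_full:
  assumes "F \<subseteq> E'" "card (nb E c) = 2" "2 \<le> card (nb F c)"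
  shows "{a, c} \<in> F"
proof -
  have fin: "finite (nb E' c)" by (rule nb_finite[OF simple_sup])
  have "card (nb E' c) = 2" using nb_sup[of E c] assms(2) ab bc ab_neq by simp
  \<comment> \<open>\<open>c\<close> has only two neighbours in the suppressed graph, so degree 2 in
    \<open>F\<close> uses both of its edges.\<close>
  then have "nb F c = nb E' c" using nb_mono[OF assms(1), of c] fin assms(3)
    by (intro card_seteq) auto
  moreover have "a \<in> nb E' c" by (simp add: nb_def sup_edges_def)
  ultimately have "a \<in> nb F c" by simp
  then show ?thesis by (simp add: nb_def)
qed

text \<open>Either both edges at \<open>b\<close> are used and get merged, or they are dropped.
  Dropping lowers only the degrees of \<open>a\<close>, \<open>b\<close> and \<open>c\<close>, and
  then \<open>full\<close> keeps \<open>a\<close> and \<open>c\<close> out of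
  \<open>N\<close>.\<close>

lemma yes_forward:
  assumes F: "F \<subseteq> E" "acyc F" "\<forall>v\<in>N. 2 \<le> card (nb F v)"
    and full: "{a, b} \<in> F \<and> {b, c} \<in> F \<or> a \<notin> N \<and> c \<notin> N"
  shows "\<exists>F'\<subseteq>E'. acyc F' \<and> (\<forall>v\<in>N - {b}. 2 \<le> card (nb F' v))"
proof (cases "{a, b} \<in> F \<and> {b, c} \<in> F")
  case True
  then have "acyc (sup_edges F a b c)"
    unfolding sup_edges_def by (intro acyc_suppress[OF F(2)]) (use ac in auto)
  moreover have "sup_edges F a b c \<subseteq> E'" using F(1) by (auto simp: sup_edges_def)
  ultimately show ?thesis using F(3) nb_sup[OF F(1)] True
    by (intro exI[of _ "sup_edges F a b c"]) auto
next
  case False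
  let ?F = "F - {{a, b}, {b, c}}"
  have "nb ?F v = nb F v" if "v \<noteq> a" "v \<noteq> b" "v \<noteq> c" for v
    using that by (auto simp: nb_def doubleton_eq_iff)
  moreover have "acyc ?F" by (rule acyc_subset[OF F(2)]) auto
  moreover have "?F \<subseteq> E'" using F(1) by (auto simp: sup_edges_def)
  ultimately show ?thesis using F(3) full False by (intro exI[of _ ?F]) (metis Diff_iff singletonI)
qed

lemma unsup_yes:
  assumes F: "F \<subseteq> E'" "acyc F" "\<forall>v\<in>N - {b}. 2 \<le> card (nb F v)" and "{a, c} \<in> F"
  shows "\<exists>F\<subseteq>E. acyc F \<and> (\<forall>v\<in>N. 2 \<le> card (nb F v))"
proof (intro exI[of _ "unsup F"] conjI ballI)
  show sub: "unsup F \<subseteq> E" using unsup_subset F(1) by blast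
  show "acyc (unsup F)" unfolding unsup_def
    by (rule acyc_subdivide[OF F(2) assms(4)]) (use b_notin_sup F(1) in blast)
  fix v assume "v \<in> N"
  then show "2 \<le> card (nb (unsup F) v)"
    using nb_unsup[OF F(1) assms(4), of v] F(3) nb_b_card[OF _ _ sub]
    by (cases "v = b") (auto simp: unsup_def)
qed

text \<open>If \<open>{a, c}\<close> is missing, the second edge \<open>{c, d}\<close> at \<open>c\<close> is given up in order to attach
  the path \<open>a, b, c\<close> without creating a cycle.\<close>

lemma yes_backward:
  assumes "b \<in> N" "card (nb E c) = 2" "c \<in> N \<or> \<not> nb E c \<subseteq> N"
    and F: "F \<subseteq> E'" "acyc F" "\<forall>v\<in>N - {b}. 2 \<le> card (nb F v)"
  shows "\<exists>F\<subseteq>E. acyc F \<and> (\<forall>v\<in>N. 2 \<le> card (nb F v))"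
proof (cases "{a, c} \<in> F")
  case True
  then show ?thesis using unsup_yes F by blast
next
  case False
  then have cN: "c \<notin> N" using nb_sup_full[OF F(1) assms(2)] F(3) ab_neq by blast
  have "b \<in> nb E c" using bc by (simp add: nb_def)
  then obtain d where d: "nb E c = {b, d}" "d \<noteq> b"
    using assms(2) unfolding card_2_iff by (metis insert_commute insert_iff singletonD)
  \<comment> \<open>\<open>b\<close> lies in \<open>N\<close>, so the neighbour of \<open>c\<close>
    outside \<open>N\<close> can only be \<open>d\<close>.\<close>
  have dN: "d \<notin> N" using assms(1,3) cN d by auto
  let ?G = "F - {{c, d}}"
  have FE: "F \<subseteq> E" using False F(1) by (auto simp: sup_edges_def)
  \<comment> \<open>With \<open>{a, c}\<close> absent and \<open>{b, c}\<close> gone through the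
    suppression, \<open>{c, d}\<close> is the only edge that \<open>F\<close> may have at
    \<open>c\<close>.\<close>
  have c_iso: "c \<notin> e" if "e \<in> ?G" for e
  proof
    assume "c \<in> e"
    have "e \<in> E" using that FE by blast
    then obtain u where u: "e = {u, c}" using sg \<open>c \<in> e\<close> by (auto elim!: simple_graph_edgeE)
    then have "u \<in> {b, d}" using \<open>e \<in> E\<close> d by (auto simp: nb_def)
    then show False using u that b_notin_sup F(1) by (auto simp: insert_commute)
  qed
  have b_iso: "b \<notin> e" if "e \<in> ?G" for e using that b_notin_sup F(1) by blast
  have "acyc (insert {a, b} ?G)"
    by (rule acyc_pendant) (use acyc_subset[OF F(2)] b_iso ab_neq in auto)
  then have "acyc (insert {b, c} (insert {a, b} ?G))"
    by (rule acyc_pendant) (use c_iso ab_neq ac in auto)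
  moreover have sub: "insert {b, c} (insert {a, b} ?G) \<subseteq> E" using FE ab bc by auto
  moreover have "2 \<le> card (nb (insert {b, c} (insert {a, b} ?G)) v)" if "v \<in> N" for v
  proof (cases "v = b")
    case True then show ?thesis using nb_b_card[OF _ _ sub] by simp
  next
    case False
    \<comment> \<open>Only \<open>{c, d}\<close> was deleted, and both its ends are outside
      \<open>N\<close>.\<close>
    have "nb F v \<subseteq> nb (insert {b, c} (insert {a, b} ?G)) v"
      using that cN dN by (auto simp: nb_def doubleton_eq_iff)
    moreover have "finite (nb (insert {b, c} (insert {a, b} ?G)) v)"
      by (rule nb_finite[OF simple_graph_subset[OF sg sub]])
    ultimately have "card (nb F v) \<le> card (nb (insert {b, c} (insert {a, b} ?G)) v)"
      by (rule card_mono[rotated])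
    moreover have "2 \<le> card (nb F v)" using F(3) that False by blast
    ultimately show ?thesis by linarith
  qed
  ultimately show ?thesis by (intro exI[of _ "insert {b, c} (insert {a, b} ?G)"]) auto
qed

lemma swap: "suppression V E c b a"
  using sg cg nbb ac nac by unfold_locales (auto simp: insert_commute)

lemma sup_edges_swap: "sup_edges E c b a = E'"
  by (auto simp: sup_edges_def insert_commute)

lemma ntst_yes_sup:
  assumes red: "reducible V E N a b c"
  shows "ntst_yes V E N \<longleftrightarrow> ntst_yes V' E' (N - {b})"
  unfolding ntst_yes_iff[OF sg cg] ntst_yes_iff[OF simple_sup connected_sup]
proof
  assume "\<exists>F\<subseteq>E. acyc F \<and> (\<forall>v\<in>N. 2 \<le> card (nb F v))"
  then obtain F where F: "F \<subseteq> E" "acyc F" "\<forall>v\<in>N. 2 \<le> card (nb F v)" by blast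
  have fin: "finite (nb E v)" for v by (rule nb_finite[OF sg])
  \<comment> \<open>Degree 2 in the graph forces a solution to take every edge at a vertex of
    \<open>N\<close>.\<close>
  have full: "nb F v = nb E v" if "v \<in> N" "card (nb E v) = 2" for v
    using that F(3) nb_mono[OF F(1)] fin by (intro card_seteq) auto
  have "{a, b} \<in> F \<and> {b, c} \<in> F \<or> a \<notin> N \<and> c \<notin> N"
  proof (cases "b \<in> N")
    case True
    then have "nb F b = {a, c}" using full[of b] nbb ac by simp
    then show ?thesis by (auto simp: nb_def insert_commute)
  next
    case False
    then have "a \<notin> N \<and> c \<notin> N \<or> nb F a = nb E a \<and> nb F c = nb E c"
      using red full[of a] full[of c] by (auto simp: reducible_def)
    then show ?thesis using ab bc by (auto simp: nb_def insert_commute)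
  qed
  then show "\<exists>F\<subseteq>E'. acyc F \<and> (\<forall>v\<in>N - {b}. 2 \<le> card (nb F v))"
    using yes_forward F by blast
next
  assume "\<exists>F\<subseteq>E'. acyc F \<and> (\<forall>v\<in>N - {b}. 2 \<le> card (nb F v))"
  then obtain F where F: "F \<subseteq> E'" "acyc F" "\<forall>v\<in>N - {b}. 2 \<le> card (nb F v)" by blast
  \<comment> \<open>\<open>yes_backward\<close> gives up an edge at \<open>c\<close>; the mirrored
    locale does the same at \<open>a\<close>.\<close>
  interpret sw: suppression V E c b a by (rule swap)
  have F': "F \<subseteq> sup_edges E c b a" using F sup_edges_swap by simp
  have c2: "card (nb E c) = 2" "card (nb E a) = 2" using red by (auto simp: reducible_def)
  show "\<exists>F\<subseteq>E. acyc F \<and> (\<forall>v\<in>N. 2 \<le> card (nb F v))"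
  proof (cases "b \<in> N")
    case True
    then have "(c \<in> N \<or> \<not> nb E c \<subseteq> N) \<or> (a \<in> N \<or> \<not> nb E a \<subseteq> N)"
      using red by (auto simp: reducible_def)
    then show ?thesis
      using yes_backward[OF True c2(1) _ F] sw.yes_backward[OF True c2(2) _ F' F(2,3)] by blast
  next
    case False
    show ?thesis
    proof (cases "{a, c} \<in> F")
      case True
      then show ?thesis using unsup_yes F by blast
    next
      case nF: False
      then have "c \<notin> N" using nb_sup_full[OF F(1) c2(1)] F(3) ab_neq by blast
      then have "a \<notin> N" using red False by (auto simp: reducible_def)
      moreover have "F \<subseteq> E" using nF F(1) by (auto simp: sup_edges_def)
      ultimately show ?thesis using F False by (intro exI[of _ F]) auto
    qed
  qed
qed

lemma ntst_instance_sup: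
  assumes "ntst_instance V E N" "reducible V E N a b c"
  shows "ntst_instance V' E' (N - {b})"
proof -
  have finV: "finite V" using sg by (simp add: simple_graph_def)
  have N: "N \<subseteq> V" "card N + 2 \<le> card V" using assms by (auto simp: ntst_instance_def)
  have "finite N" using N finV finite_subset by blast
  have "card (N - {b}) + 2 \<le> card V'"
  proof (cases "b \<in> N")
    case True
    then show ?thesis
      using N(2) card.remove[OF finV in_V(2)] card.remove[OF \<open>finite N\<close>, of b] by linarith
  next
    case False
    then have "3 \<le> card V - card N"
      using assms(2) N \<open>finite N\<close> by (auto simp: reducible_def card_Diff_subset)
    then show ?thesis using False in_V finV by (simp add: card_Diff_singleton)
  qed
  then show ?thesis using simple_sup connected_sup N by (auto simp: ntst_instance_def)
qed

end

section \<open>The size of irreducible graphs\<close>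

text \<open>Two equal entries at minimal distance \<open>d\<close> would bound a cycle:
  \<open>d = 1\<close> contradicts that edges have two ends, and \<open>d = 2\<close> would be a
  turn.\<close>

lemma nonbacktracking_inj:
  assumes "simple_graph V T" "acyc T"
    and edge: "\<And>i. i < n \<Longrightarrow> {f i, f (Suc i)} \<in> T"
    and nb: "\<And>i. Suc i < n \<Longrightarrow> f i \<noteq> f (i + 2)"
  shows "inj_on f {..n}"
proof (rule ccontr)
  assume "\<not> inj_on f {..n}"
  then have ex: "\<exists>d i. 0 < d \<and> i + d \<le> n \<and> f i = f (i + d)"
    unfolding inj_on_def by (metis atMost_iff le_add_diff_inverse linorder_neqE_nat less_imp_le zero_less_diff)
  define d where "d = (LEAST d. \<exists>i. 0 < d \<and> i + d \<le> n \<and> f i = f (i + d))"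
  obtain i where i: "0 < d" "i + d \<le> n" "f i = f (i + d)"
    using LeastI_ex[OF ex] unfolding d_def by blast
  have least: "f j \<noteq> f (j + e)" if "0 < e" "e < d" "j + e \<le> n" for j e
    using not_less_Least[of e "\<lambda>d. \<exists>i. 0 < d \<and> i + d \<le> n \<and> f i = f (i + d)"] that
    unfolding d_def by blast
  have "f i \<noteq> f (Suc i)" using edge[of i] i simple_graph_edge(3)[OF assms(1)] by simp
  then have "d \<noteq> 1" using i by auto
  moreover have "d \<noteq> 2" using i nb[of i] by auto
  ultimately have d3: "d \<ge> 3" using i by simp
  have "cycle_in T (map f [i..<i + d])"
    unfolding cycle_in_def
  proof (intro conjI allI impI)
    show "3 \<le> length (map f [i..<i + d])" using d3 by simp
    have "inj_on f {i..<i + d}"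
    proof (rule linorder_inj_onI)
      fix x y assume "x < y" "x \<in> {i..<i + d}" "y \<in> {i..<i + d}"
      then show "f x \<noteq> f y" using least[of "y - x" x] i(2) by auto
    qed auto
    then show "distinct (map f [i..<i + d])" by (simp add: distinct_map)
    fix j assume "j < length (map f [i..<i + d])"
    then have j: "j < d" by simp
    show "{map f [i..<i + d] ! j, map f [i..<i + d] ! (Suc j mod length (map f [i..<i + d]))} \<in> T"
    proof (cases "Suc j = d")
      case True
      then have "Suc (i + j) = i + d" "i + j < n" using i by auto
      then have "{f (i + j), f i} \<in> T" using edge[of "i + j"] i(3) by metis
      then show ?thesis using True j i(1) by simp
    next
      case False
      then show ?thesis using edge[of "i + j"] i j by simp
    qed
  qed
  then show False using cycle_imp_not_acyc assms(2) by blast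
qed

section \<open>Edge exchanges that gain a leaf\<close>

lemma rtrancl_enter:
  assumes "(w, u) \<in> R\<^sup>*" "w \<notin> S" "u \<in> S"
  obtains t s where "t \<notin> S" "s \<in> S" "(t, s) \<in> R" "(w, t) \<in> {(x, y) \<in> R. x \<notin> S \<and> y \<notin> S}\<^sup>*"
proof -
  have "w \<notin> S \<longrightarrow> (\<exists>t s. t \<notin> S \<and> s \<in> S \<and> (t, s) \<in> R \<and>
      (w, t) \<in> {(x, y) \<in> R. x \<notin> S \<and> y \<notin> S}\<^sup>*)"
    using assms(1)
  proof (induction rule: converse_rtrancl_induct)
    case base
    then show ?case using assms(3) by simp
  next
    case (step w z)
    show ?case
    proof (cases "z \<in> S")
      case True
      then show ?thesis using step.hyps by blast
    next
      case False
      show ?thesis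
      proof
        assume "w \<notin> S"
        then have "(w, z) \<in> {(x, y) \<in> R. x \<notin> S \<and> y \<notin> S}" using False step.hyps by simp
        then show "\<exists>t s. t \<notin> S \<and> s \<in> S \<and> (t, s) \<in> R \<and>
            (w, t) \<in> {(x, y) \<in> R. x \<notin> S \<and> y \<notin> S}\<^sup>*"
          using step.IH False by (meson converse_rtrancl_into_rtrancl)
      qed
    qed
  qed
  then show thesis using assms(2) that by blast
qed

text \<open>Replacing \<open>{r, s}\<close> by \<open>{u, w}\<close> makes \<open>r\<close> a leaf.
  If \<open>w\<close> differs from \<open>s\<close>, then \<open>s\<close> becomes a leaf too and at
  most \<open>w\<close> ceases to be one; if \<open>w = s\<close>, no leaf is lost. As
  \<open>u\<close> has degree 2, its extra edge costs no leaf.\<close>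

lemma swap_edge_gains_leaf:
  assumes sg: "simple_graph V E" and T: "T \<subseteq> E" "connected_graph V T"
    and deg: "nb T r = {u, s}" "u \<noteq> s" "card (nb T s) = 2" "card (nb T u) = 2"
    and w: "{u, w} \<in> E" "{u, w} \<notin> T" "(w, s) \<in> (adj (T - {{r, s}}))\<^sup>*"
  shows "leafy V E (Suc (card (leaves V T)))"
proof -
  let ?H = "insert {u, w} (T - {{r, s}})"
  have sT: "simple_graph V T" and sH: "simple_graph V ?H"
    using T w(1) by (auto intro!: simple_graph_subset[OF sg])
  have ur: "{u, r} \<in> T" "{s, r} \<in> T" using deg(1) by (auto simp: nb_def)
  have neq: "u \<noteq> r" "s \<noteq> r" "u \<noteq> w" "w \<noteq> r"
    using simple_graph_edge[OF sT ur(1)] simple_graph_edge[OF sT ur(2)]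
      simple_graph_edge[OF sg w(1)] ur(1) w(2) by auto
  have V: "r \<in> V" "s \<in> V" "finite V"
    using simple_graph_edge[OF sT ur(1)] simple_graph_edge[OF sT ur(2)] sg
    by (auto simp: simple_graph_def)
  have "connected_graph V ?H"
  proof (rule connected_transfer[OF T(2)])
    have "(r, u) \<in> adj ?H" "(u, w) \<in> adj ?H"
      using ur deg(2) neq by (auto simp: insert_commute doubleton_eq_iff)
    moreover have "(w, s) \<in> (adj ?H)\<^sup>*" by (rule adj_mono[OF _ w(3)]) auto
    ultimately have rs: "(r, s) \<in> (adj ?H)\<^sup>*" by (meson converse_rtrancl_into_rtrancl)
    fix x y assume xy: "{x, y} \<in> T"
    show "(x, y) \<in> (adj ?H)\<^sup>*"
    proof (cases "{x, y} = {r, s}")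
      case True
      then show ?thesis using rs adj_rtrancl_sym[OF rs] by (auto simp: doubleton_eq_iff)
    next
      case False
      then have "(x, y) \<in> adj ?H" using xy by simp
      then show ?thesis by blast
    qed
  qed
  moreover have "Suc (card (leaves V T)) \<le> card (leaves V ?H)"
  proof -
    have L: "v \<in> leaves V T \<longleftrightarrow> v \<in> V \<and> card (nb T v) = 1"
      "v \<in> leaves V ?H \<longleftrightarrow> v \<in> V \<and> card (nb ?H v) = 1" for v
      using vdegree_nb[OF sT] vdegree_nb[OF sH] by (auto simp: leaves_def)
    have "nb ?H r = {u}" using deg(1,2) neq by (auto simp: nb_def doubleton_eq_iff)
    then have r: "r \<in> leaves V ?H" using V L by simp
    have "card (nb T r) = 2" using deg by simp
    then have notl: "r \<notin> leaves V T" "s \<notin> leaves V T" "u \<notin> leaves V T" using deg L by auto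
    have other: "v \<in> leaves V ?H" if "v \<in> leaves V T" "v \<noteq> w" for v
    proof -
      have "v \<noteq> r" "v \<noteq> s" "v \<noteq> u" using that notl by auto
      then have "nb ?H v = nb T v" using that(2) by (auto simp: nb_def doubleton_eq_iff)
      then show ?thesis using that(1) L by simp
    qed
    have fin: "finite (leaves V T)" "finite (leaves V ?H)" using V by (auto simp: leaves_def)
    show ?thesis
    proof (cases "w = s")
      case True
      then have "insert r (leaves V T) \<subseteq> leaves V ?H" using r other notl by auto
      then have "card (insert r (leaves V T)) \<le> card (leaves V ?H)"
        by (rule card_mono[OF fin(2)])
      then show ?thesis using notl fin by simp
    next
      case False
      have "nb ?H s = nb T s - {r}"
        using False deg(2) neq by (auto simp: nb_def doubleton_eq_iff)
      moreover have "r \<in> nb T s" using ur by (simp add: nb_def insert_commute)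
      ultimately have "card (nb ?H s) = 1" using deg(3) by simp
      then have "s \<in> leaves V ?H" using L V by simp
      then have "insert r (insert s (leaves V T - {w})) \<subseteq> leaves V ?H" using r other by auto
      then have "card (insert r (insert s (leaves V T - {w}))) \<le> card (leaves V ?H)"
        by (rule card_mono[OF fin(2)])
      moreover have "card (leaves V T) \<le> Suc (card (leaves V T - {w}))"
        using card_Suc_Diff1[OF fin(1), of w] by (cases "w \<in> leaves V T") auto
      ultimately show ?thesis using notl neq fin by simp
    qed
  qed
  ultimately show ?thesis using T w unfolding leafy_def by (intro exI[of _ ?H]) auto
qed

text \<open>An extra edge \<open>{u, w}\<close> closes a cycle with the tree that leaves the ball
  through \<open>p\<close> or through \<open>s\<close>. Breaking it at the outer edge on that side
  gains a leaf, against maximality.\<close>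

lemma max_leafy_degree_2:
  assumes sg: "simple_graph V E" and T: "T \<subseteq> E" "connected_graph V T"
    and max: "\<not> leafy V E (Suc (card (leaves V T)))"
    and q: "nb T q = {p, u}" "p \<noteq> u" and u: "nb T u = {q, r}" "q \<noteq> r"
    and r: "nb T r = {u, s}" "u \<noteq> s" and ps: "card (nb T p) = 2" "card (nb T s) = 2"
  shows "nb E u = nb T u"
proof (rule ccontr)
  assume "nb E u \<noteq> nb T u"
  then obtain w where w: "w \<in> nb E u" "w \<notin> nb T u" using nb_mono[OF T(1), of u] by blast
  then have uw: "{u, w} \<in> E" "{u, w} \<notin> T" by (auto simp: nb_def insert_commute)
  have "w \<noteq> u" using simple_graph_edge(3)[OF sg uw(1)] by simp
  then have wS: "w \<notin> {q, u, r}" using w u by auto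
  have "(w, u) \<in> (adj T)\<^sup>*"
    using T(2) simple_graph_edge[OF sg uw(1)] by (simp add: connected_graph_iff)
  then obtain t x where tx: "t \<notin> {q, u, r}" "x \<in> {q, u, r}" "(t, x) \<in> adj T"
    and wt: "(w, t) \<in> {(x, y) \<in> adj T. x \<notin> {q, u, r} \<and> y \<notin> {q, u, r}}\<^sup>*"
    using rtrancl_enter[of w u "adj T" "{q, u, r}"] wS by blast
  \<comment> \<open>The walk up to the first entrance uses no edge at \<open>q\<close> or
    \<open>r\<close>, so it survives the deletion of one.\<close>
  have reach: "(w, t) \<in> (adj (T - {e}))\<^sup>*" if "q \<in> e \<or> r \<in> e" for e
  proof -
    have "{(x, y) \<in> adj T. x \<notin> {q, u, r} \<and> y \<notin> {q, u, r}} \<subseteq> adj (T - {e})"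
      using that by auto
    then show ?thesis using wt rtrancl_mono by blast
  qed
  have "t \<in> nb T x" using tx(3) by (simp add: nb_def)
  \<comment> \<open>The entrance cannot be at \<open>u\<close>, whose tree neighbours both lie in
    the set; it leads from \<open>p\<close> into \<open>q\<close> or from \<open>s\<close> into
    \<open>r\<close>.\<close>
  then consider "t = p" | "t = s" using tx q u r by auto
  then show False
  proof cases
    case 1
    have "leafy V E (Suc (card (leaves V T)))"
      by (rule swap_edge_gains_leaf[OF sg T, of q u p w])
        (use q u ps uw reach[of "{q, p}"] 1 in \<open>auto simp: insert_commute\<close>)
    then show False using max by simp
  next
    case 2
    have "leafy V E (Suc (card (leaves V T)))"
      by (rule swap_edge_gains_leaf[OF sg T, of r u s w])
        (use r u ps uw reach[of "{r, s}"] 2 in auto)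
    then show False using max by simp
  qed
qed

section \<open>Degree sums and layers of walks in a tree\<close>

lemma acyc_minimal:
  assumes "simple_graph V T" "acyc T" "T\<^sub>0 \<subseteq> T" "connected_graph V T\<^sub>0"
  shows "T \<subseteq> T\<^sub>0"
proof (rule ccontr)
  assume "\<not> T \<subseteq> T\<^sub>0"
  then obtain e where e: "e \<in> T" "e \<notin> T\<^sub>0" by blast
  obtain u v where uv: "e = {u, v}" "u \<in> V" "v \<in> V" using assms(1) e(1) by (rule simple_graph_edgeE)
  have "(u, v) \<in> (adj T\<^sub>0)\<^sup>*" using assms(4) uv by (simp add: connected_graph_iff)
  then have "(u, v) \<in> (adj (T - {{u, v}}))\<^sup>*"
    by (rule adj_mono[rotated]) (use assms(3) e uv in auto)
  then show False using assms(2) e uv by (auto simp: acyc_def)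
qed

text \<open>The edges from each vertex to a neighbour closer to a fixed root already connect the
  tree, hence they are all its edges.\<close>

lemma tree_degree_sum:
  assumes sg: "simple_graph V T" and cg: "connected_graph V T" and "acyc T"
  shows "(\<Sum>v\<in>V. card (nb T v)) + 2 \<le> 2 * card V"
proof -
  have finV: "finite V" using sg by (simp add: simple_graph_def)
  obtain r where r: "r \<in> V" using cg by (auto simp: connected_graph_iff)
  define d where "d v = (LEAST n. (r, v) \<in> adj T ^^ n)" for v
  have ex: "\<exists>p. {p, v} \<in> T \<and> d p < d v" if v: "v \<in> V - {r}" for v
  proof -
    have "(r, v) \<in> (adj T)\<^sup>*" using r v cg by (auto simp: connected_graph_iff)
    then have "\<exists>n. (r, v) \<in> adj T ^^ n" by (simp add: rtrancl_power)
    then have dv: "(r, v) \<in> adj T ^^ d v" unfolding d_def by (rule LeastI_ex)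
    then obtain m where m: "d v = Suc m" using v by (cases "d v") auto
    then obtain p where p: "(r, p) \<in> adj T ^^ m" "(p, v) \<in> adj T" using dv by auto
    have "d p \<le> m" unfolding d_def by (rule Least_le) (rule p(1))
    then show ?thesis using p(2) m by auto
  qed
  then obtain p where p: "\<And>v. v \<in> V - {r} \<Longrightarrow> {p v, v} \<in> T \<and> d (p v) < d v" by metis
  define T\<^sub>0 where "T\<^sub>0 = (\<lambda>v. {p v, v}) ` (V - {r})"
  have T0: "T\<^sub>0 \<subseteq> T" using p by (auto simp: T\<^sub>0_def)
  have root: "(r, v) \<in> (adj T\<^sub>0)\<^sup>*" if "v \<in> V" for v
    using that
  proof (induction "d v" arbitrary: v rule: less_induct)
    case less
    show ?case
    proof (cases "v = r")
      case False
      then have v: "v \<in> V - {r}" using less.prems by simp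
      have "p v \<in> V" using p[OF v] simple_graph_edge[OF sg] by blast
      then have "(r, p v) \<in> (adj T\<^sub>0)\<^sup>*" using less.hyps p[OF v] by blast
      moreover have "(p v, v) \<in> adj T\<^sub>0" using v by (auto simp: T\<^sub>0_def)
      ultimately show ?thesis by (rule rtrancl_into_rtrancl)
    qed simp
  qed
  have "(u, v) \<in> (adj T\<^sub>0)\<^sup>*" if "u \<in> V" "v \<in> V" for u v
    using adj_rtrancl_sym[OF root[OF that(1)]] root[OF that(2)] by (rule rtrancl_trans)
  then have "connected_graph V T\<^sub>0" using r by (auto simp: connected_graph_iff)
  then have sub: "T \<subseteq> T\<^sub>0" using acyc_minimal[OF sg assms(3) T0] by simp
  \<comment> \<open>Each parent edge accounts for two ordered pairs, and every vertex but the root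
    has one parent edge.\<close>
  let ?A = "(\<lambda>v. (p v, v)) ` (V - {r})" and ?B = "(\<lambda>v. (v, p v)) ` (V - {r})"
  have "Sigma V (nb T) \<subseteq> ?A \<union> ?B"
  proof
    fix z assume "z \<in> Sigma V (nb T)"
    then obtain x y where z: "z = (x, y)" "{y, x} \<in> T" by (auto simp: nb_def)
    then obtain v where "v \<in> V - {r}" "{y, x} = {p v, v}" using sub by (auto simp: T\<^sub>0_def)
    then show "z \<in> ?A \<union> ?B" using z by (auto simp: doubleton_eq_iff)
  qed
  then have "card (Sigma V (nb T)) \<le> card (?A \<union> ?B)" using finV by (intro card_mono) auto
  also have "\<dots> \<le> card ?A + card ?B" by (rule card_Un_le)
  also have "\<dots> \<le> 2 * card (V - {r})"
    using card_image_le[of "V - {r}" "\<lambda>v. (p v, v)"] card_image_le[of "V - {r}" "\<lambda>v. (v, p v)"] finV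
    by simp
  also have "Suc (card (V - {r})) = card V" using card_Suc_Diff1 finV r by metis
  then have "2 * card (V - {r}) + 2 = 2 * card V" by simp
  finally show ?thesis using nb_finite[OF sg] finV \<open>2 * card (V - {r}) + 2 = 2 * card V\<close>
    by (simp add: card_SigmaI)
qed

text \<open>A pair is a directed step of a walk. The walks start outside \<open>D\<close> and pass
  through vertices of \<open>D\<close> without turning back; layer \<open>j\<close> holds their last
  steps after \<open>j\<close> vertices of \<open>D\<close>. Where \<open>D\<close> has degree 2
  they cannot branch, so the layers do not grow.\<close>

primrec layer :: "'a set \<Rightarrow> 'a set set \<Rightarrow> 'a set \<Rightarrow> nat \<Rightarrow> ('a \<times> 'a) set" where
  "layer V T D 0 = {(z, w). z \<in> V - D \<and> w \<in> nb T z}"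
| "layer V T D (Suc j) = {(v, w). v \<in> D \<and> w \<in> nb T v \<and> (\<exists>x. (x, v) \<in> layer V T D j \<and> w \<noteq> x)}"

lemma layer_edge: "e \<in> layer V T D j \<Longrightarrow> snd e \<in> nb T (fst e)"
  by (cases j) auto

lemma card_layer:
  assumes sg: "simple_graph V T" and D: "\<And>v. v \<in> D \<Longrightarrow> card (nb T v) = 2"
  shows "finite (layer V T D j) \<and> card (layer V T D j) \<le> (\<Sum>v\<in>V - D. card (nb T v))"
proof (induction j)
  case 0
  have "layer V T D 0 = Sigma (V - D) (nb T)" by auto
  then show ?case using nb_finite[OF sg] sg by (simp add: simple_graph_def card_SigmaI)
next
  case (Suc j)
  \<comment> \<open>The step that follows \<open>(x, v)\<close> without turning back; it is unique
    because \<open>v\<close> has degree 2.\<close>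
  define g where "g = (\<lambda>(x, v). (v, THE w. w \<in> nb T v \<and> w \<noteq> x))"
  have "layer V T D (Suc j) \<subseteq> g ` layer V T D j"
  proof
    fix e assume "e \<in> layer V T D (Suc j)"
    then obtain v w x where e: "e = (v, w)" "v \<in> D" "w \<in> nb T v" "(x, v) \<in> layer V T D j" "w \<noteq> x"
      by auto
    have "x \<in> nb T v" using layer_edge[OF e(4)] nb_sym by fastforce
    then have "nb T v = {x, w}" using D[OF e(2)] e(3,5) by (auto simp: card_2_iff)
    then have "(THE w. w \<in> nb T v \<and> w \<noteq> x) = w" using e(5) by auto
    then have "e = g (x, v)" using e by (simp add: g_def)
    then show "e \<in> g ` layer V T D j" using e(4) by blast
  qed
  then have "finite (layer V T D (Suc j))" "card (layer V T D (Suc j)) \<le> card (layer V T D j)"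
    using Suc.IH surj_card_le[of "layer V T D j" "layer V T D (Suc j)" g] finite_surj by blast+
  then show ?case using Suc.IH by linarith
qed

text \<open>The step \<open>(x, v)\<close> is traced backwards. If \<open>x\<close> were outside
  \<open>D\<close>, the step would be in layer 0; so \<open>x\<close> has another neighbour
  \<open>w\<close>, and the preceding step \<open>(w, x)\<close> avoids all layers but possibly the
  last, since its layer index is one less.\<close>

lemma walk_outside_layers:
  assumes sg: "simple_graph V T" and D: "\<And>v. v \<in> D \<Longrightarrow> card (nb T v) = 2"
    and "{x, v} \<in> T" "\<And>j. j \<le> m \<Longrightarrow> (x, v) \<notin> layer V T D j"
  shows "\<exists>f. f 0 = v \<and> f 1 = x \<and> (\<forall>i\<le>m. f (Suc i) \<in> D \<and> {f i, f (Suc i)} \<in> T) \<and>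
    (\<forall>i<m. f i \<noteq> f (i + 2))"
  using assms(3,4)
proof (induction m arbitrary: x v)
  case 0
  then have "x \<in> D" using simple_graph_edge[OF sg] 0(2)[of 0] by (auto simp: nb_def insert_commute)
  then show ?case using 0(1) by (intro exI[of _ "case_nat v (\<lambda>_. x)"]) (simp add: insert_commute)
next
  case (Suc m)
  have xD: "x \<in> D" using Suc.prems(2)[of 0] Suc.prems(1) simple_graph_edge[OF sg Suc.prems(1)]
    by (auto simp: nb_def insert_commute)
  have v: "v \<in> nb T x" using Suc.prems(1) by (simp add: nb_def insert_commute)
  then obtain w where w: "w \<in> nb T x" "w \<noteq> v" using D[OF xD] by (auto simp: card_2_iff)
  have "(w, x) \<notin> layer V T D j" if "j \<le> m" for j
    using Suc.prems(2)[of "Suc j"] that xD v w by auto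
  moreover have "{w, x} \<in> T" using w by (simp add: nb_def)
  ultimately obtain g where g: "g 0 = x" "g 1 = w"
    "\<forall>i\<le>m. g (Suc i) \<in> D \<and> {g i, g (Suc i)} \<in> T" "\<forall>i<m. g i \<noteq> g (i + 2)"
    using Suc.IH by blast
  let ?f = "case_nat v g"
  have "?f (Suc i) \<in> D \<and> {?f i, ?f (Suc i)} \<in> T" if "i \<le> Suc m" for i
    using that g xD Suc.prems(1) by (cases i) (auto simp: insert_commute)
  moreover have "?f i \<noteq> ?f (i + 2)" if "i < Suc m" for i
    using that g w by (cases i) auto
  ultimately show ?case using g by (intro exI[of _ ?f]) auto
qed

text \<open>Two vertices at each end only complete the balls of radius 2. Thus \<open>f 2\<close> to
  \<open>f 7\<close> have degree 2 in the graph, and \<open>f 3\<close> to \<open>f 6\<close>, whose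
  neighbours are among these, are the candidates for suppression.\<close>

lemma long_path_reducible:
  assumes sg: "simple_graph V E" and T: "T \<subseteq> E" "connected_graph V T" "acyc T"
    and max: "\<not> leafy V E (Suc (card (leaves V T)))"
    and deg: "\<And>i. i \<le> 9 \<Longrightarrow> card (nb T (f i)) = 2"
    and edge: "\<And>i. i < 9 \<Longrightarrow> {f i, f (Suc i)} \<in> T"
    and nonb: "\<And>i. i < 8 \<Longrightarrow> f i \<noteq> f (i + 2)"
  shows "\<exists>a b c. reducible V E N a b c"
proof (rule ccontr)
  assume irr: "\<not> ?thesis"
  have sT: "simple_graph V T" using simple_graph_subset[OF sg T(1)] .
  have inj: "inj_on f {..9}" by (rule nonbacktracking_inj[OF sT T(3)]) (use edge nonb in auto)
  have nbT: "nb T (f (Suc i)) = {f i, f (Suc (Suc i))}" if "i < 8" for i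
  proof -
    have "f i \<in> nb T (f (Suc i))" "f (Suc (Suc i)) \<in> nb T (f (Suc i))"
      using edge[of i] edge[of "Suc i"] that by (auto simp: nb_def insert_commute)
    moreover have "f i \<noteq> f (Suc (Suc i))" using nonb[of i] that by simp
    ultimately show ?thesis using deg[of "Suc i"] that by (auto simp: card_2_iff)
  qed
  have nbE: "nb E (f (Suc (Suc i))) = {f (Suc i), f (Suc (Suc (Suc i)))}" if "i < 6" for i
  proof -
    have "nb E (f (Suc (Suc i))) = nb T (f (Suc (Suc i)))"
      by (rule max_leafy_degree_2[OF sg T(1,2) max, of "f (Suc i)" "f i" _ "f (i+3)" "f (i+4)"])
        (use that nbT[of i] nbT[of "i+1"] nbT[of "i+2"] deg[of i] deg[of "i+4"]
          nonb[of i] nonb[of "i+1"] nonb[of "i+2"] in \<open>auto simp: numeral_eq_Suc\<close>)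
    then show ?thesis using nbT[of "Suc i"] that by simp
  qed
  have cardE: "card (nb E (f (Suc (Suc i)))) = 2" if "i < 6" for i
    using nbE[OF that] nonb[of "Suc i"] that by simp
  \<comment> \<open>The clause on the neighbourhoods of \<open>f (i - 1)\<close> and
    \<open>f (i + 1)\<close> reduces to \<open>f (i - 2)\<close> and \<open>f (i + 2)\<close>,
    because the other neighbour \<open>f i\<close> is in \<open>N\<close>.\<close>
  have cond: "\<not> (if f i \<in> N then f (i - 1) \<in> N \<or> f (i + 1) \<in> N \<or> f (i - 2) \<notin> N \<or> f (i + 2) \<notin> N
      else (f (i - 1) \<in> N \<longleftrightarrow> f (i + 1) \<in> N) \<and> 3 \<le> card (V - N))" if "3 \<le> i" "i \<le> 6" for i
  proof -
    define j where "j = i - 3"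
    have j: "i = j + 3" "j < 4" using that by (auto simp: j_def)
    have "f (j+4) \<noteq> f (j+1)" using inj j by (auto simp: inj_on_eq_iff)
    then have "f (j+4) \<notin> nb E (f (j+2))" using nbE[of j] nonb[of "j+2"] edge[of "j+3"]
        simple_graph_edge(3)[OF sT, of "f (j+3)" "f (j+4)"] j by (auto simp: numeral_eq_Suc)
    then have "{f (j+2), f (j+4)} \<notin> E" by (simp add: nb_def insert_commute)
    moreover have "\<not> reducible V E N (f (j+2)) (f (j+3)) (f (j+4))" using irr by blast
    ultimately show ?thesis
      using nbE[of j] nbE[of "j+1"] nbE[of "j+2"] cardE[of j] cardE[of "j+2"] nonb[of "j+2"] j
      unfolding reducible_def by (auto simp: numeral_eq_Suc split: if_splits)
  qed
  note c = cond[of 3] cond[of 4] cond[of 5] cond[of 6]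
  show False
  proof (cases "3 \<le> card (V - N)")
    case True
    \<comment> \<open>If \<open>f 4\<close> were in \<open>N\<close>, then \<open>f 3\<close> would
      be outside \<open>N\<close> between the members \<open>f 2\<close> and \<open>f 4\<close>,
      hence suppressible; likewise \<open>f 5\<close> in \<open>N\<close> would make
      \<open>f 4\<close> suppressible. With both outside \<open>N\<close>, failure at
      \<open>f 4\<close> puts \<open>f 3\<close> into \<open>N\<close>, and failure at
      \<open>f 3\<close> then puts \<open>f 5\<close> into \<open>N\<close>.\<close>
    then show ?thesis using c by (auto split: if_splits)
  next
    case False
    \<comment> \<open>A member of \<open>N\<close> at which the rule fails has both path neighbours
      outside \<open>N\<close>. Failure at \<open>f 3\<close>, \<open>f 4\<close> and
      \<open>f 6\<close> thus supplies three different vertices outside \<open>N\<close>.\<close>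
    obtain i1 where i1: "i1 \<in> {2, 3}" "f i1 \<notin> N" using c(1) by (auto split: if_splits)
    obtain i2 where i2: "i2 \<in> {4, 5}" "f i2 \<notin> N" using c(2) by (auto split: if_splits)
    obtain i3 where i3: "i3 \<in> {6, 7}" "f i3 \<notin> N" using c(4) by (auto split: if_splits)
    have "f i \<in> V" if "i < 9" for i using simple_graph_edge[OF sT edge[OF that]] by simp
    then have "{f i1, f i2, f i3} \<subseteq> V - N" using i1 i2 i3 by auto
    then have "card {f i1, f i2, f i3} \<le> card (V - N)"
      by (rule card_mono[rotated]) (use sg in \<open>simp add: simple_graph_def\<close>)
    moreover have "card {f i1, f i2, f i3} = 3"
      using i1 i2 i3 inj by (auto simp: inj_on_eq_iff)
    ultimately show ?thesis using False by simp
  qed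
qed

lemma irreducible_card_bound:
  assumes sg: "simple_graph V E" and cg: "connected_graph V E" and "2 \<le> card V"
    and irr: "\<And>a b c. \<not> reducible V E N a b c"
  shows "\<exists>k. leafy V E k \<and> card V \<le> 38 * k"
proof -
  have finV: "finite V" using sg by (simp add: simple_graph_def)
  have "leafy V E 0" using cg by (auto simp: leafy_def)
  moreover have bound: "k \<le> card V" if k: "leafy V E k" for k
  proof -
    obtain H where "k \<le> card (leaves V H)" using k by (auto simp: leafy_def)
    also have "\<dots> \<le> card V" using finV by (intro card_mono) (auto simp: leaves_def)
    finally show ?thesis .
  qed
  ultimately obtain k where k: "leafy V E k" "\<And>l. leafy V E l \<Longrightarrow> l \<le> k"
    using Greatest_le_nat GreatestI_nat by metis
  obtain T where T: "T \<subseteq> E" "connected_graph V T" "acyc T" "k \<le> card (leaves V T)"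
    using leafy_acyc[OF sg k(1) assms(3)] by blast
  have lT: "leafy V E (card (leaves V T))" using T by (auto simp: leafy_def)
  have max: "\<not> leafy V E (Suc (card (leaves V T)))" using k(2) T(4) by fastforce
  have sT: "simple_graph V T" using simple_graph_subset[OF sg T(1)] .
  define D where "D = {v \<in> V. card (nb T v) = 2}"
  define A where "A = {v \<in> V. card (nb T v) = 1}"
  define B where "B = {v \<in> V. 3 \<le> card (nb T v)}"
  have A: "A = leaves V T" using vdegree_nb[OF sT] by (auto simp: A_def leaves_def)
  have fin: "finite A" "finite B" "finite D" using finV by (auto simp: A_def B_def D_def)
  have pos: "card (nb T v) > 0" if "v \<in> V" for v
    using nb_nonempty[OF T(2) assms(3) that] nb_finite[OF sT] by (simp add: card_gt_0_iff)
  have split: "V - D = A \<union> B" "A \<inter> B = {}" "V = (A \<union> B) \<union> D" "(A \<union> B) \<inter> D = {}"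
    using pos by (fastforce simp: A_def B_def D_def)+
  have cV: "card V = card A + card B + card D"
    using split fin by (metis card_Un_disjoint finite_Un)
  define S where "S = (\<Sum>v\<in>V - D. card (nb T v))"
  have "(\<Sum>v\<in>V. card (nb T v)) = S + (\<Sum>v\<in>D. card (nb T v))"
    unfolding S_def by (rule sum.subset_diff) (use finV in \<open>auto simp: D_def\<close>)
  also have "(\<Sum>v\<in>D. card (nb T v)) = 2 * card D" by (simp add: D_def)
  finally have "S + 2 * card D + 2 \<le> 2 * card V" using tree_degree_sum[OF sT T(2,3)] by simp
  moreover have "S = (\<Sum>v\<in>A. card (nb T v)) + (\<Sum>v\<in>B. card (nb T v))"
    unfolding S_def split(1) by (rule sum.union_disjoint) (use fin split in auto)
  moreover have "(\<Sum>v\<in>A. card (nb T v)) = card A" by (simp add: A_def)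
  moreover have "(\<Sum>v\<in>B. 3) \<le> (\<Sum>v\<in>B. card (nb T v))"
    by (rule sum_mono) (simp add: B_def)
  \<comment> \<open>The degree sum gives \<open>S + 2 \<le> 2 * card A + 2 * card B\<close>, while
    \<open>S\<close> is at least \<open>card A + 3 * card B\<close>; so there are fewer branching
    vertices than leaves.\<close>
  ultimately have SB: "S \<le> 4 * card A" "card B \<le> card A" using cV by auto
  \<comment> \<open>A vertex of \<open>D\<close> missed by layers 0 to 8 would start a walk through
    ten vertices of \<open>D\<close>, which contains a suppressible vertex.\<close>
  have "D \<subseteq> snd ` (\<Union>j<9. layer V T D j)"
  proof (rule subsetI, rule ccontr)
    fix v assume v: "v \<in> D" "v \<notin> snd ` (\<Union>j<9. layer V T D j)"
    have deg: "card (nb T u) = 2" if "u \<in> D" for u using that by (simp add: D_def)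
    obtain x where x: "{x, v} \<in> T" using deg[OF v(1)] by (force simp: nb_def card_2_iff)
    have "(x, v) \<notin> layer V T D j" if "j \<le> 8" for j
      using v(2) that by (force simp: image_iff)
    then have "\<exists>f. f 0 = v \<and> f 1 = x \<and> (\<forall>i\<le>8. f (Suc i) \<in> D \<and> {f i, f (Suc i)} \<in> T) \<and>
        (\<forall>i<8. f i \<noteq> f (i + 2))"
      by (intro walk_outside_layers[OF sT deg x])
    then obtain f where f: "f 0 = v" "\<forall>i\<le>8. f (Suc i) \<in> D \<and> {f i, f (Suc i)} \<in> T"
      "\<forall>i<8. f i \<noteq> f (i + 2)" by (elim exE conjE)
    have "f i \<in> D" if "i \<le> 9" for i using f(1,2) v(1) that by (cases i) auto
    then have "\<exists>a b c. reducible V E N a b c"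
      by (intro long_path_reducible[OF sg T(1-3) max, of f]) (use f deg in auto)
    then show False using irr by blast
  qed
  then have "card D \<le> card (snd ` (\<Union>j<9. layer V T D j))"
    by (rule card_mono[rotated]) (use card_layer[OF sT, of D] in \<open>auto simp: D_def\<close>)
  also have "\<dots> \<le> card (\<Union>j<9. layer V T D j)"
    by (rule card_image_le) (use card_layer[OF sT, of D] in \<open>auto simp: D_def\<close>)
  also have "\<dots> \<le> (\<Sum>j<9. card (layer V T D j))" by (rule card_UN_le) simp
  also have "\<dots> \<le> (\<Sum>j<(9::nat). S)"
    by (rule sum_mono) (use card_layer[OF sT, of D] in \<open>auto simp: D_def S_def\<close>)
  finally have "card D \<le> 9 * S" by simp
  \<comment> \<open>Here 38 is 9 times 4 for the vertices in \<open>D\<close> plus 2 for leaves and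
    branching vertices.\<close>
  then have "card V \<le> 38 * card A" using SB cV by linarith
  then show ?thesis using lT A by blast
qed

section \<open>Symbolic evaluation of programs\<close>

text \<open>A weakest precondition on value and time that includes termination. Its rules are
  equivalences, so the simplifier can execute programs.\<close>

definition wp :: "program \<Rightarrow> data list \<Rightarrow> expr \<Rightarrow> (data \<Rightarrow> nat \<Rightarrow> bool) \<Rightarrow> bool" where
  "wp P \<rho> e Q \<longleftrightarrow> (\<exists>v t. eval P \<rho> e v t \<and> Q v t)"

definition wps :: "program \<Rightarrow> data list \<Rightarrow> expr list \<Rightarrow> (data list \<Rightarrow> nat \<Rightarrow> bool) \<Rightarrow> bool" where
  "wps P \<rho> es Q \<longleftrightarrow> (\<exists>vs t. evals P \<rho> es vs t \<and> Q vs t)"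

lemma wp_Arg [simp]: "wp P \<rho> (EArg i) Q \<longleftrightarrow> i < length \<rho> \<and> Q (\<rho> ! i) 1"
  unfolding wp_def
  by (rule iffI; (elim exE conjE)?) (erule eval_elims(1), simp, blast intro: eval_Arg)

lemma wp_Null [simp]: "wp P \<rho> ENull Q \<longleftrightarrow> Q Null 1"
  unfolding wp_def
  by (rule iffI; (elim exE conjE)?) (erule eval_elims(2), simp, blast intro: eval_Null)

lemma wp_Cell [simp]:
  "wp P \<rho> (ECell e1 e2) Q \<longleftrightarrow> wp P \<rho> e1 (\<lambda>v t. wp P \<rho> e2 (\<lambda>w s. Q (Cell v w) (t + s + 1)))"
  unfolding wp_def
  by (rule iffI; elim exE conjE)
    (erule eval_elims(3), force, blast intro: eval_Cell)

lemma wp_Head [simp]: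
  "wp P \<rho> (EHead e) Q \<longleftrightarrow> wp P \<rho> e (\<lambda>v t. Q (head v) (t + 1))"
  unfolding wp_def
  by (rule iffI; elim exE conjE)
    (erule eval_elims(4), force, blast intro: eval_Head)

lemma wp_Tail [simp]:
  "wp P \<rho> (ETail e) Q \<longleftrightarrow> wp P \<rho> e (\<lambda>v t. Q (tail v) (t + 1))"
  unfolding wp_def
  by (rule iffI; elim exE conjE)
    (erule eval_elims(5), force, blast intro: eval_Tail)

lemma wp_If [simp]:
  "wp P \<rho> (EIf e e1 e2) Q \<longleftrightarrow> wp P \<rho> e (\<lambda>v t. if v \<noteq> Null
     then wp P \<rho> e1 (\<lambda>w s. Q w (t + s + 1)) else wp P \<rho> e2 (\<lambda>w s. Q w (t + s + 1)))"
proof -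
  have "wp P \<rho> (EIf e e1 e2) Q \<longleftrightarrow> (\<exists>v t. eval P \<rho> e v t \<and>
      (v \<noteq> Null \<and> (\<exists>w s. eval P \<rho> e1 w s \<and> Q w (t + s + 1)) \<or>
       v = Null \<and> (\<exists>w s. eval P \<rho> e2 w s \<and> Q w (t + s + 1))))"
    unfolding wp_def
    by (rule iffI; elim exE conjE disjE)
      (erule eval_elims(6), force, force, blast intro: eval_If_True, blast intro: eval_If_False)
  then show ?thesis unfolding wp_def by (simp only: if_bool_eq_disj) blast
qed

lemma wp_Call [simp]:
  "wp P \<rho> (ECall f es) Q \<longleftrightarrow> f < length P \<and>
     wps P \<rho> es (\<lambda>vs t. wp P vs (P ! f) (\<lambda>w s. Q w (t + s + 1)))"
  unfolding wp_def wps_def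
  by (rule iffI; elim exE conjE)
    (erule eval_elims(7), force, blast intro: eval_Call)

lemma wps_Nil [simp]: "wps P \<rho> [] Q \<longleftrightarrow> Q [] 0"
  unfolding wps_def
  by (rule iffI; (elim exE conjE)?) (erule eval_elims(8), simp, blast intro: evals_Nil)

lemma wps_Cons [simp]:
  "wps P \<rho> (e # es) Q \<longleftrightarrow> wp P \<rho> e (\<lambda>v t. wps P \<rho> es (\<lambda>vs s. Q (v # vs) (t + s)))"
  unfolding wp_def wps_def
  by (rule iffI; elim exE conjE)
    (erule eval_elims(9), force, blast intro: evals_Cons)

text \<open>The congruence rules keep the simplifier out of the continuation until the value passed to
  it is known.\<close>

lemma wp_weak_cong [cong]: "\<rho> = \<rho>' \<Longrightarrow> e = e' \<Longrightarrow> wp P \<rho> e Q = wp P \<rho>' e' Q"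
  by simp

lemma wps_weak_cong [cong]: "\<rho> = \<rho>' \<Longrightarrow> e = e' \<Longrightarrow> wps P \<rho> e Q = wps P \<rho>' e' Q"
  by simp

definition computes :: "program \<Rightarrow> nat \<Rightarrow> data list \<Rightarrow> data \<Rightarrow> nat \<Rightarrow> bool" where
  "computes P f \<rho> v B \<longleftrightarrow> (\<exists>t\<le>B. eval P \<rho> (P ! f) v t)"

text \<open>The exact time, unique by determinism and kept symbolic: \<open>computes_wp\<close>
  replaces a call by its value and this time, which \<open>computes_cost\<close> bounds
  separately.\<close>

definition cost :: "program \<Rightarrow> nat \<Rightarrow> data list \<Rightarrow> nat" where
  "cost P f \<rho> = (THE t. \<exists>v. eval P \<rho> (P ! f) v t)"

lemma computesI:
  "wp P \<rho> (P ! f) (\<lambda>w t. w = v \<and> t \<le> B) \<Longrightarrow> computes P f \<rho> v B"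
  by (auto simp: wp_def computes_def)

lemma computes_mono: "computes P f \<rho> v B \<Longrightarrow> B \<le> B' \<Longrightarrow> computes P f \<rho> v B'"
  by (auto simp: computes_def intro: order_trans)

lemma
  assumes "computes P f \<rho> v B"
  shows computes_cost: "cost P f \<rho> \<le> B"
    and computes_wp: "wp P \<rho> (P ! f) Q \<longleftrightarrow> Q v (cost P f \<rho>)"
proof -
  obtain t where t: "t \<le> B" "eval P \<rho> (P ! f) v t" using assms by (auto simp: computes_def)
  have "cost P f \<rho> = t"
    unfolding cost_def using t(2) eval_deterministic(1)[OF t(2)] by (intro the_equality) metis+
  moreover have "wp P \<rho> (P ! f) Q \<longleftrightarrow> Q v t"
    unfolding wp_def using t(2) eval_deterministic(1)[OF t(2)] by metis
  ultimately show "cost P f \<rho> \<le> B" "wp P \<rho> (P ! f) Q \<longleftrightarrow> Q v (cost P f \<rho>)"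
    using t(1) by simp_all
qed

section \<open>The reduction as a program\<close>

abbreviation dn :: "nat \<Rightarrow> data" where "dn \<equiv> data_of_nat"
abbreviation dl :: "nat list \<Rightarrow> data" where "dl xs \<equiv> data_of_list (map data_of_nat xs)"
abbreviation de :: "(nat \<times> nat) list \<Rightarrow> data" where "de es \<equiv> data_of_list (map data_of_edge es)"

definition dbool :: "bool \<Rightarrow> data" where
  "dbool b = (if b then Cell Null Null else Null)"

lemma dbool_Null [simp]: "dbool b = Null \<longleftrightarrow> \<not> b"
  by (simp add: dbool_def)

lemma dl_Null [simp]: "data_of_list xs = Null \<longleftrightarrow> xs = []"
  by (cases xs) auto

text \<open>Lets the structural equality test of the program compare vertices.\<close>

lemma data_of_nat_inj: "dn u = dn v \<Longrightarrow> u = v"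
proof (induction u arbitrary: v rule: less_induct)
  case (less u)
  have zero: "dn w = Null \<longleftrightarrow> w = 0" for w
    by (subst data_of_nat.simps) simp
  show ?case
  proof (cases "u = 0 \<or> v = 0")
    case True
    then show ?thesis using less.prems zero by metis
  next
    case False
    then have "dn (u div 2) = dn (v div 2)" "odd u = odd v"
      using less.prems data_of_nat.simps[of u] data_of_nat.simps[of v] by (auto split: if_splits)
    then have "u div 2 = v div 2" using less.IH False by simp
    then show ?thesis using \<open>odd u = odd v\<close> by presburger
  qed
qed

lemma dn_eq [simp]: "dn u = dn v \<longleftrightarrow> u = v"
  using data_of_nat_inj by blast

abbreviation ETrue :: expr where "ETrue \<equiv> ECell ENull ENull"
abbreviation EAnd :: "expr \<Rightarrow> expr \<Rightarrow> expr" where "EAnd e e' \<equiv> EIf e e' ENull"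
abbreviation ENot :: "expr \<Rightarrow> expr" where "ENot e \<equiv> EIf e ENull ETrue"
abbreviation EPair :: "expr \<Rightarrow> expr" where
  "EPair e \<equiv> EIf (ETail e) (EIf (ETail (ETail e)) ENull ETrue) ENull"

text \<open>Functions 0 to 5: main (instance), loop (instance, fuel), scan and attempt (vertices,
  edges, non-terminals, candidates for \<open>b\<close>), and the test of the suppression rule. Functions 6 to
  11: equality, membership, neighbours, deletion of a vertex from a vertex list, deletion of its
  edges, and difference of vertex lists.\<close>

definition kernel :: program where
  "kernel = [
    ECall 1 [EArg 0, EHead (EArg 0)],
    EIf (EArg 1)
      (ECall 1 [ECall 2 [EHead (EArg 0), EHead (ETail (EArg 0)), ETail (ETail (EArg 0)), EHead (EArg 0)],
         ETail (EArg 1)])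
      (EArg 0),
    EIf (EArg 3)
      (ECall 3 [EArg 0, EArg 1, EArg 2, EArg 3, EHead (EArg 3), ECall 8 [EHead (EArg 3), EArg 1]])
      (ECell (EArg 0) (ECell (EArg 1) (EArg 2))),
    EIf (ECall 4 [EArg 0, EArg 1, EArg 2, EArg 4, EArg 5])
      (ECell (ECall 9 [EArg 4, EArg 0])
        (ECell
          (ECell (ECell (EHead (EArg 5)) (EHead (ETail (EArg 5)))) (ECall 10 [EArg 4, EArg 1]))
          (ECall 9 [EArg 4, EArg 2])))
      (ECall 2 [EArg 0, EArg 1, EArg 2, ETail (EArg 3)]),
    EAnd (EPair (EArg 4))
      (ECall 5 [EArg 0, EArg 1, EArg 2, EArg 3, EHead (EArg 4), EHead (ETail (EArg 4)),
        ECall 8 [EHead (EArg 4), EArg 1], ECall 8 [EHead (ETail (EArg 4)), EArg 1]]),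
    EAnd (EPair (EArg 6)) (EAnd (EPair (EArg 7)) (EAnd (ENot (ECall 7 [EArg 5, EArg 6]))
      (EIf (ECall 7 [EArg 3, EArg 2])
        (EIf (ECall 7 [EArg 4, EArg 2]) ETrue
          (EIf (ECall 7 [EArg 5, EArg 2]) ETrue
            (ENot (EAnd (EAnd (ECall 7 [EHead (EArg 6), EArg 2]) (ECall 7 [EHead (ETail (EArg 6)), EArg 2]))
              (EAnd (ECall 7 [EHead (EArg 7), EArg 2]) (ECall 7 [EHead (ETail (EArg 7)), EArg 2]))))))
        (EAnd
          (EIf (ECall 7 [EArg 4, EArg 2]) (ECall 7 [EArg 5, EArg 2]) (ENot (ECall 7 [EArg 5, EArg 2])))
          (EIf (ETail (ETail (ECall 11 [EArg 0, EArg 2]))) ETrue ENull))))),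
    EIf (EArg 0)
      (EIf (EArg 1)
        (EAnd (ECall 6 [EHead (EArg 0), EHead (EArg 1)]) (ECall 6 [ETail (EArg 0), ETail (EArg 1)]))
        ENull)
      (ENot (EArg 1)),
    EIf (EArg 1)
      (EIf (ECall 6 [EArg 0, EHead (EArg 1)]) ETrue (ECall 7 [EArg 0, ETail (EArg 1)]))
      ENull,
    EIf (EArg 1)
      (EIf (ECall 6 [EArg 0, EHead (EHead (EArg 1))])
        (ECell (ETail (EHead (EArg 1))) (ECall 8 [EArg 0, ETail (EArg 1)]))
        (EIf (ECall 6 [EArg 0, ETail (EHead (EArg 1))])
          (ECell (EHead (EHead (EArg 1))) (ECall 8 [EArg 0, ETail (EArg 1)]))
          (ECall 8 [EArg 0, ETail (EArg 1)])))
      ENull,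
    EIf (EArg 1)
      (EIf (ECall 6 [EArg 0, EHead (EArg 1)])
        (ECall 9 [EArg 0, ETail (EArg 1)])
        (ECell (EHead (EArg 1)) (ECall 9 [EArg 0, ETail (EArg 1)])))
      ENull,
    EIf (EArg 1)
      (EIf (ECall 6 [EArg 0, EHead (EHead (EArg 1))])
        (ECall 10 [EArg 0, ETail (EArg 1)])
        (EIf (ECall 6 [EArg 0, ETail (EHead (EArg 1))])
          (ECall 10 [EArg 0, ETail (EArg 1)])
          (ECell (EHead (EArg 1)) (ECall 10 [EArg 0, ETail (EArg 1)]))))
      ENull,
    EIf (EArg 0)
      (EIf (ECall 7 [EHead (EArg 0), EArg 1])
        (ECall 11 [ETail (EArg 0), EArg 1])
        (ECell (EHead (EArg 0)) (ECall 11 [ETail (EArg 0), EArg 1])))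
      ENull]"

section \<open>Values and costs of the list functions\<close>

lemma length_kernel [simp]: "length kernel = 12"
  by (simp add: kernel_def)

lemmas kernel_0 = arg_cong[OF kernel_def, of "\<lambda>P. P ! 0", simplified, folded One_nat_def]
lemmas kernel_1 = arg_cong[OF kernel_def, of "\<lambda>P. P ! 1", simplified, folded One_nat_def]
lemmas kernel_2 = arg_cong[OF kernel_def, of "\<lambda>P. P ! 2", simplified]
lemmas kernel_3 = arg_cong[OF kernel_def, of "\<lambda>P. P ! 3", simplified]
lemmas kernel_4 = arg_cong[OF kernel_def, of "\<lambda>P. P ! 4", simplified]
lemmas kernel_5 = arg_cong[OF kernel_def, of "\<lambda>P. P ! 5", simplified]
lemmas kernel_6 = arg_cong[OF kernel_def, of "\<lambda>P. P ! 6", simplified]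
lemmas kernel_7 = arg_cong[OF kernel_def, of "\<lambda>P. P ! 7", simplified]
lemmas kernel_8 = arg_cong[OF kernel_def, of "\<lambda>P. P ! 8", simplified]
lemmas kernel_9 = arg_cong[OF kernel_def, of "\<lambda>P. P ! 9", simplified]
lemmas kernel_10 = arg_cong[OF kernel_def, of "\<lambda>P. P ! 10", simplified]
lemmas kernel_11 = arg_cong[OF kernel_def, of "\<lambda>P. P ! 11", simplified]

text \<open>Each of the two recursive calls at a cell carries the additive 20, so 20 of the 40 steps
  allotted to the cell remain for its own overhead.\<close>

lemma computes_eq: "computes kernel 6 [x, y] (dbool (x = y)) (40 * size x + 20)"
proof (induction x arbitrary: y)
  case Null
  show ?case
    by (rule computesI) (simp add: kernel_6 dbool_def)
next
  case (Cell a b)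
  note h = computes_wp[OF Cell.IH(1)] computes_wp[OF Cell.IH(2)]
  show ?case
    using computes_cost[OF Cell.IH(1)[of "head y"]] computes_cost[OF Cell.IH(2)[of "tail y"]]
    by (intro computesI, subst kernel_6) (cases y; simp add: h dbool_def)
qed

fun neighbours :: "nat \<Rightarrow> (nat \<times> nat) list \<Rightarrow> nat list" where
  "neighbours v [] = []"
| "neighbours v ((x, y) # es) = (if v = x then y # neighbours v es
     else if v = y then x # neighbours v es else neighbours v es)"

abbreviation del_edges :: "nat \<Rightarrow> (nat \<times> nat) list \<Rightarrow> (nat \<times> nat) list" where
  "del_edges v es \<equiv> filter (\<lambda>e. v \<noteq> fst e \<and> v \<noteq> snd e) es"

lemma data_of_edge_pair [simp]: "data_of_edge (u, v) = Cell (dn u) (dn v)"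
  by (simp add: data_of_edge_def)

lemmas computes_eq_dn = computes_eq[of "dn u" "dn v" for u v, unfolded dn_eq]
lemmas wp_eq [simp] = computes_wp[OF computes_eq_dn]
lemmas cost_eq = computes_cost[OF computes_eq_dn]

lemma computes_mem:
  assumes "size (dn v) \<le> n"
  shows "computes kernel 7 [dn v, dl xs] (dbool (v \<in> set xs)) (length xs * (80 * n + 100) + 100)"
proof (induction xs)
  case Nil
  show ?case by (rule computesI) (simp add: kernel_7 dbool_def)
next
  case (Cons x xs)
  show ?case
    using computes_cost[OF Cons.IH] cost_eq[of v x] assms
    by (intro computesI, subst kernel_7) (auto simp: computes_wp[OF Cons.IH] dbool_def)
qed

lemma computes_neighbours:
  assumes "size (dn v) \<le> n"
  shows "computes kernel 8 [dn v, de es] (dl (neighbours v es)) (length es * (80 * n + 100) + 100)"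
proof (induction es)
  case Nil
  show ?case by (rule computesI) (simp add: kernel_8)
next
  case (Cons e es)
  show ?case
    using computes_cost[OF Cons.IH] cost_eq[of v "fst e"] cost_eq[of v "snd e"] assms
    by (intro computesI, subst kernel_8, cases e)
      (auto simp: computes_wp[OF Cons.IH])
qed

lemma computes_del:
  assumes "size (dn v) \<le> n"
  shows "computes kernel 9 [dn v, dl xs] (dl (filter (\<lambda>u. v \<noteq> u) xs)) (length xs * (80 * n + 100) + 100)"
  using assms
proof (induction xs arbitrary: v)
  case Nil
  show ?case by (rule computesI) (simp add: kernel_9)
next
  case (Cons x xs)
  show ?case
    using computes_cost[OF Cons.IH, of v] cost_eq[of v x] Cons.prems
    by (intro computesI, subst kernel_9) (auto simp: computes_wp[OF Cons.IH])
qed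

lemma computes_del_edges:
  assumes "size (dn v) \<le> n"
  shows "computes kernel 10 [dn v, de es] (de (del_edges v es)) (length es * (80 * n + 100) + 100)"
  using assms
proof (induction es arbitrary: v)
  case Nil
  show ?case by (rule computesI) (simp add: kernel_10)
next
  case (Cons e es)
  show ?case
    using computes_cost[OF Cons.IH, of v] cost_eq[of v "fst e"] cost_eq[of v "snd e"] Cons.prems
    by (intro computesI, subst kernel_10, cases e)
      (auto simp: computes_wp[OF Cons.IH])
qed

definition scan_cost :: "nat \<Rightarrow> nat" where
  "scan_cost n = n * (80 * n + 100) + 100"

lemma scan_cost_mono: "k \<le> n \<Longrightarrow> k * (80 * n + 100) + 100 \<le> scan_cost n"
  unfolding scan_cost_def by (intro add_mono mult_le_mono1 order_refl)

text \<open>The value does not depend on the size bound \<open>n\<close> of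
  \<open>computes_mem\<close>; taking for \<open>n\<close> the size itself gives a rewrite rule
  without side condition.\<close>

lemma wp_mem [simp]:
  "wp kernel [dn v, dl xs] (kernel ! 7) Q \<longleftrightarrow> Q (dbool (v \<in> set xs)) (cost kernel 7 [dn v, dl xs])"
  by (rule computes_wp[OF computes_mem[OF order_refl]])

lemma wp_neighbours [simp]:
  "wp kernel [dn v, de es] (kernel ! 8) Q \<longleftrightarrow> Q (dl (neighbours v es)) (cost kernel 8 [dn v, de es])"
  by (rule computes_wp[OF computes_neighbours[OF order_refl]])

lemma wp_del [simp]:
  "wp kernel [dn v, dl xs] (kernel ! 9) Q \<longleftrightarrow>
     Q (dl (filter (\<lambda>u. v \<noteq> u) xs)) (cost kernel 9 [dn v, dl xs])"
  by (rule computes_wp[OF computes_del[OF order_refl]])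

lemma wp_del_edges [simp]:
  "wp kernel [dn v, de es] (kernel ! 10) Q \<longleftrightarrow>
     Q (de (del_edges v es)) (cost kernel 10 [dn v, de es])"
  by (rule computes_wp[OF computes_del_edges[OF order_refl]])

lemma cost_scans:
  assumes "size (dn v) \<le> n"
  shows "length xs \<le> n \<Longrightarrow> cost kernel 7 [dn v, dl xs] \<le> scan_cost n"
    and "length es \<le> n \<Longrightarrow> cost kernel 8 [dn v, de es] \<le> scan_cost n"
    and "length xs \<le> n \<Longrightarrow> cost kernel 9 [dn v, dl xs] \<le> scan_cost n"
    and "length es \<le> n \<Longrightarrow> cost kernel 10 [dn v, de es] \<le> scan_cost n"
  using computes_cost[OF computes_mem[OF assms]] computes_cost[OF computes_neighbours[OF assms]]
    computes_cost[OF computes_del[OF assms]] computes_cost[OF computes_del_edges[OF assms]]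
    scan_cost_mono order_trans by blast+

lemma computes_diff:
  assumes "\<And>v. v \<in> set xs \<Longrightarrow> size (dn v) \<le> n" "length ns \<le> n"
  shows "computes kernel 11 [dl xs, dl ns] (dl (filter (\<lambda>u. u \<notin> set ns) xs))
    (length xs * (scan_cost n + 50) + 50)"
  using assms(1)
proof (induction xs)
  case Nil
  show ?case by (rule computesI) (simp add: kernel_11)
next
  case (Cons x xs)
  then have IH: "computes kernel 11 [dl xs, dl ns] (dl (filter (\<lambda>u. u \<notin> set ns) xs))
    (length xs * (scan_cost n + 50) + 50)" by simp
  show ?case
    using computes_cost[OF IH] cost_scans(1)[of x n ns] assms Cons.prems
    by (intro computesI, subst kernel_11) (auto simp: computes_wp[OF IH])
qed

lemma wp_diff [simp]:
  "wp kernel [dl xs, dl ns] (kernel ! 11) Q \<longleftrightarrow>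
     Q (dl (filter (\<lambda>u. u \<notin> set ns) xs)) (cost kernel 11 [dl xs, dl ns])"
proof (rule computes_wp[OF computes_diff])
  \<comment> \<open>One concrete number that bounds all element sizes and the length of
    \<open>ns\<close> at once.\<close>
  show "size (dn v) \<le> (\<Sum>v\<leftarrow>xs. size (dn v)) + length ns" if "v \<in> set xs" for v
    using member_le_sum_list[of "size (dn v)" "map (\<lambda>v. size (dn v)) xs"] that by auto
qed simp

definition diff_cost :: "nat \<Rightarrow> nat" where
  "diff_cost n = n * (scan_cost n + 50) + 50"

lemma cost_diff:
  assumes "\<And>v. v \<in> set xs \<Longrightarrow> size (dn v) \<le> n" "length ns \<le> n" "length xs \<le> n"
  shows "cost kernel 11 [dl xs, dl ns] \<le> diff_cost n"
proof -
  have "cost kernel 11 [dl xs, dl ns] \<le> length xs * (scan_cost n + 50) + 50"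
    by (rule computes_cost[OF computes_diff]) (use assms in auto)
  also have "\<dots> \<le> diff_cost n" unfolding diff_cost_def by (intro add_mono mult_le_mono1 assms(3) order_refl)
  finally show ?thesis .
qed

section \<open>The suppression rule on lists\<close>

definition is_pair :: "'a list \<Rightarrow> bool" where
  "is_pair l \<longleftrightarrow> length l = 2"

lemma is_pairE:
  assumes "is_pair l" obtains a b where "l = [a, b]"
  using assms that by (auto simp: is_pair_def length_Suc_conv numeral_2_eq_2)

text \<open>\<open>la\<close> and \<open>lc\<close> stand for the neighbour lists of
  \<open>a\<close> and \<open>c\<close>. With the check of \<open>b\<close> in
  \<open>applicable\<close>, this is \<open>reducible\<close> on lists.\<close>

definition rule_test :: "nat list \<Rightarrow> nat list \<Rightarrow> nat \<Rightarrow> nat \<Rightarrow> nat \<Rightarrow> nat list \<Rightarrow> nat list \<Rightarrow> bool" where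
  "rule_test vs ns b a c la lc \<longleftrightarrow> is_pair la \<and> is_pair lc \<and> c \<notin> set la \<and>
     (if b \<in> set ns then a \<in> set ns \<or> c \<in> set ns \<or> \<not> set la \<subseteq> set ns \<or> \<not> set lc \<subseteq> set ns
      else (a \<in> set ns \<longleftrightarrow> c \<in> set ns) \<and> 3 \<le> length (filter (\<lambda>u. u \<notin> set ns) vs))"

text \<open>As \<open>tail Null\<close> is \<open>Null\<close>, one and two tails decide whether a
  list is a pair; two tails also detect three vertices outside \<open>N\<close>.\<close>

lemma tail_Null_iff: "tail (dl l) = Null \<longleftrightarrow> length l \<le> 1"
  by (cases l) (auto simp: Suc_le_eq)

lemma tail_tail_Null_iff: "tail (tail (dl l)) = Null \<longleftrightarrow> length l \<le> 2"
  by (cases l; cases "List.tl l") auto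

lemma computes_rule_test:
  assumes "\<And>v. v \<in> set vs \<union> {a, b, c} \<union> set la \<union> set lc \<Longrightarrow> size (dn v) \<le> n"
    "length vs \<le> n" "length ns \<le> n" "length la \<le> n" 
  shows "computes kernel 5 [dl vs, x, dl ns, dn b, dn a, dn c, dl la, dl lc]
    (dbool (rule_test vs ns b a c la lc)) (20 * scan_cost n + diff_cost n + 200)"
proof (cases "is_pair la \<and> is_pair lc")
  case False
  then show ?thesis
    by (intro computesI, subst kernel_5)
      (auto simp: tail_Null_iff tail_tail_Null_iff is_pair_def rule_test_def dbool_def)
next
  case True
  then obtain p q r s where l: "la = [p, q]" "lc = [r, s]" by (meson is_pairE)
  have c: "cost kernel 7 [dn v, dl xs] \<le> scan_cost n" if "v \<in> {a, b, c, p, q, r, s}" "xs \<in> {ns, la}" for v xs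
  proof (rule cost_scans(1))
    show "size (dn v) \<le> n" by (rule assms(1)) (use that(1) l in auto)
    show "length xs \<le> n" using that(2) assms(3,4) by blast
  qed
  have d: "cost kernel 11 [dl vs, dl ns] \<le> diff_cost n"
    by (rule cost_diff) (simp_all add: assms)
  have hl: "head (dl la) = dn p" "head (tail (dl la)) = dn q" "length la = 2"
    "head (dl lc) = dn r" "head (tail (dl lc)) = dn s" "length lc = 2" using l by simp_all
  have t: "rule_test vs ns b a c la lc \<longleftrightarrow> c \<notin> set la \<and>
     (if b \<in> set ns then a \<in> set ns \<or> c \<in> set ns \<or>
        \<not> ((p \<in> set ns \<and> q \<in> set ns) \<and> r \<in> set ns \<and> s \<in> set ns)
      else (a \<in> set ns \<longleftrightarrow> c \<in> set ns) \<and> \<not> length (filter (\<lambda>u. u \<notin> set ns) vs) \<le> 2)"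
    using True by (auto simp: rule_test_def l)
  show ?thesis
    by (rule computesI, subst kernel_5, simp add: hl tail_Null_iff tail_tail_Null_iff t,
        simp add: dbool_def, intro conjI impI)
      (use c[of b ns] c[of a ns] c[of c ns] c[of p ns] c[of q ns] c[of r ns] c[of s ns] c[of c la] d
        in simp_all)
qed

section \<open>Running the reduction\<close>

definition applicable :: "nat list \<Rightarrow> (nat \<times> nat) list \<Rightarrow> nat list \<Rightarrow> nat \<Rightarrow> nat list \<Rightarrow> bool" where
  "applicable vs es ns b l \<longleftrightarrow> is_pair l \<and>
     rule_test vs ns b (l ! 0) (l ! 1) (neighbours (l ! 0) es) (neighbours (l ! 1) es)"

type_synonym instance_lists = "nat list \<times> (nat \<times> nat) list \<times> nat list"

fun encode :: "instance_lists \<Rightarrow> data" where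
  "encode (vs, es, ns) = Cell (dl vs) (Cell (de es) (dl ns))"

definition fits :: "nat \<Rightarrow> nat list \<Rightarrow> (nat \<times> nat) list \<Rightarrow> nat list \<Rightarrow> bool" where
  "fits n vs es ns \<longleftrightarrow> length vs \<le> n \<and> length es \<le> n \<and> length ns \<le> n \<and>
     (\<forall>v \<in> set vs \<union> set ns \<union> fst ` set es \<union> snd ` set es. size (dn v) \<le> n)"

lemma length_le_size: "length xs \<le> size (data_of_list xs)"
  by (induction xs) auto

lemma elem_size_le: "x \<in> set xs \<Longrightarrow> size x \<le> size (data_of_list xs)"
  by (induction xs) auto

lemma fits_encode:
  assumes "size (encode (vs, es, ns)) \<le> n" shows "fits n vs es ns"
proof -
  have s: "size (dl vs) + size (de es) + size (dl ns) \<le> n" using assms by simp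
  have e: "size (dn (fst e)) \<le> n \<and> size (dn (snd e)) \<le> n" if "e \<in> set es" for e
  proof -
    have "size (data_of_edge e) \<le> size (de es)" by (rule elem_size_le) (use that in simp)
    then show ?thesis using s by (cases e) simp
  qed
  have v: "size (dn v) \<le> n" if "v \<in> set vs \<union> set ns" for v
    using elem_size_le[of "dn v" "map dn vs"] elem_size_le[of "dn v" "map dn ns"] that s by auto
  show ?thesis
    using length_le_size[of "map dn vs"] length_le_size[of "map data_of_edge es"]
      length_le_size[of "map dn ns"] s v e unfolding fits_def by auto
qed

lemma set_neighbours_subset: "set (neighbours v es) \<subseteq> fst ` set es \<union> snd ` set es"
  by (induction v es rule: neighbours.induct) auto

lemma length_neighbours: "length (neighbours v es) \<le> length es"
  by (induction v es rule: neighbours.induct) auto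

definition test_cost :: "nat \<Rightarrow> nat" where
  "test_cost n = 22 * scan_cost n + diff_cost n + 300"

lemma computes_applicable:
  assumes f: "fits n vs es ns" and b: "size (dn b) \<le> n"
  shows "computes kernel 4 [dl vs, de es, dl ns, dn b, dl (neighbours b es)]
    (dbool (applicable vs es ns b (neighbours b es))) (test_cost n)"
proof (cases "is_pair (neighbours b es)")
  case False
  then show ?thesis
    by (intro computesI, subst kernel_4)
      (auto simp: tail_Null_iff tail_tail_Null_iff is_pair_def applicable_def dbool_def test_cost_def)
next
  case True
  then obtain a c where l: "neighbours b es = [a, c]" by (rule is_pairE)
  have size: "size (dn v) \<le> n" if "v \<in> set vs \<union> {a, b, c} \<union> set (neighbours u es)" for v u
    using that f b l set_neighbours_subset[of b es] set_neighbours_subset[of u es]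
    unfolding fits_def by auto
  have len: "length vs \<le> n" "length ns \<le> n" "length (neighbours a es) \<le> n" "length es \<le> n"
    using f length_neighbours[of a es] by (auto simp: fits_def)
  have R: "computes kernel 5 [dl vs, de es, dl ns, dn b, dn a, dn c, dl (neighbours a es), dl (neighbours c es)]
    (dbool (rule_test vs ns b a c (neighbours a es) (neighbours c es)))
    (20 * scan_cost n + diff_cost n + 200)"
    by (rule computes_rule_test) (use len size in auto)
  have "applicable vs es ns b (neighbours b es) \<longleftrightarrow>
      rule_test vs ns b a c (neighbours a es) (neighbours c es)"
    using True l by (simp add: applicable_def)
  then show ?thesis
    using computes_cost[OF R] cost_scans(2)[of a n es] cost_scans(2)[of c n es] size len
    by (intro computesI, subst kernel_4) (simp add: l computes_wp[OF R] test_cost_def)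
qed

section \<open>One round of the reduction and its iteration\<close>

fun scan :: "nat list \<Rightarrow> (nat \<times> nat) list \<Rightarrow> nat list \<Rightarrow> nat list \<Rightarrow> instance_lists" where
  "scan vs es ns [] = (vs, es, ns)"
| "scan vs es ns (b # ws) =
     (let l = neighbours b es in
      if applicable vs es ns b l
      then (filter (\<lambda>u. b \<noteq> u) vs, (l ! 0, l ! 1) # del_edges b es, filter (\<lambda>u. b \<noteq> u) ns)
      else scan vs es ns ws)"

lemma computes_scan:
  assumes f: "fits n vs es ns" and "\<And>b. b \<in> set ws \<Longrightarrow> size (dn b) \<le> n"
  shows "computes kernel 2 [dl vs, de es, dl ns, dl ws] (encode (scan vs es ns ws))
    (length ws * (test_cost n + 4 * scan_cost n + 100) + 50)"
  using assms(2)
proof (induction ws)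
  case Nil
  show ?case by (rule computesI) (simp add: kernel_2)
next
  case (Cons b ws)
  have b: "size (dn b) \<le> n" using Cons.prems by simp
  have len: "length vs \<le> n" "length ns \<le> n" "length es \<le> n" using f by (auto simp: fits_def)
  have IH: "computes kernel 2 [dl vs, de es, dl ns, dl ws] (encode (scan vs es ns ws))
    (length ws * (test_cost n + 4 * scan_cost n + 100) + 50)" using Cons by simp
  note A = computes_applicable[OF f b]
  note c = computes_cost[OF A] computes_cost[OF IH] cost_scans(2)[OF b len(3)]
    cost_scans(3)[OF b len(1)] cost_scans(3)[OF b len(2)] cost_scans(4)[OF b len(3)]
  show ?case
  proof (cases "applicable vs es ns b (neighbours b es)")
    case True
    then obtain x y where l: "neighbours b es = [x, y]"
      unfolding applicable_def by (meson is_pairE)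
    have "head (dl (neighbours b es)) = dn x" "head (tail (dl (neighbours b es))) = dn y"
      using l by simp_all
    moreover have "scan vs es ns (b # ws) =
        (filter (\<lambda>u. b \<noteq> u) vs, (x, y) # del_edges b es, filter (\<lambda>u. b \<noteq> u) ns)"
      using True l by (simp add: Let_def)
    ultimately show ?thesis using c True
      by (intro computesI, subst kernel_2) (simp add: kernel_3 computes_wp[OF A] del: scan.simps)
  next
    case False
    then have "scan vs es ns (b # ws) = scan vs es ns ws" by (simp add: Let_def)
    then show ?thesis using c False
      by (intro computesI, subst kernel_2)
        (simp add: kernel_3 computes_wp[OF A] computes_wp[OF IH] del: scan.simps)
  qed
qed

fun step :: "instance_lists \<Rightarrow> instance_lists" where
  "step (vs, es, ns) = scan vs es ns vs"

text \<open>Each deleted edge frees its other end and two cells. When \<open>b\<close> has the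
  neighbours \<open>a\<close> and \<open>c\<close>, this pays for the new edge
  \<open>{a, c}\<close>, so the encoding never grows.\<close>

lemma size_del_edges:
  "size (de (del_edges b es)) + (\<Sum>u\<leftarrow>neighbours b es. size (dn u) + 2) \<le> size (de es)"
  by (induction b es rule: neighbours.induct) auto

lemma size_filter: "size (dl (filter Q xs)) \<le> size (dl xs)"
  by (induction xs) auto

lemma size_scan: "size (encode (scan vs es ns ws)) \<le> size (encode (vs, es, ns))"
proof (induction ws)
  case (Cons b ws)
  show ?case
  proof (cases "applicable vs es ns b (neighbours b es)")
    case True
    then obtain x y where l: "neighbours b es = [x, y]"
      unfolding applicable_def by (meson is_pairE)
    have "size (encode (filter (\<lambda>u. b \<noteq> u) vs, (x, y) # del_edges b es, filter (\<lambda>u. b \<noteq> u) ns))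
        \<le> size (encode (vs, es, ns))"
      using size_del_edges[of b es] size_filter[of "\<lambda>u. b \<noteq> u" vs] size_filter[of "\<lambda>u. b \<noteq> u" ns] l
      by simp
    then show ?thesis using True l by (simp add: Let_def)
  qed (use Cons.IH in \<open>simp add: Let_def\<close>)
qed simp

lemma size_step: "size (encode (step s)) \<le> size (encode s)"
  by (cases s) (metis size_scan step.simps)

lemma size_step_iterate: "size (encode ((step ^^ k) s)) \<le> size (encode s)"
  by (induction k) (auto intro: order_trans[OF size_step])

definition step_cost :: "nat \<Rightarrow> nat" where
  "step_cost n = n * (test_cost n + 4 * scan_cost n + 100) + 50"

lemma computes_step:
  assumes "size (encode (vs, es, ns)) \<le> n"
  shows "computes kernel 2 [dl vs, de es, dl ns, dl vs] (encode (step (vs, es, ns))) (step_cost n)"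
proof (rule computes_mono)
  have f: "fits n vs es ns" using fits_encode assms by blast
  then show "computes kernel 2 [dl vs, de es, dl ns, dl vs] (encode (step (vs, es, ns)))
      (length vs * (test_cost n + 4 * scan_cost n + 100) + 50)"
    unfolding step.simps by (rule computes_scan) (use f in \<open>auto simp: fits_def\<close>)
  show "length vs * (test_cost n + 4 * scan_cost n + 100) + 50 \<le> step_cost n"
    unfolding step_cost_def using f by (intro add_mono mult_le_mono1) (auto simp: fits_def)
qed

text \<open>Only the length of the fuel \<open>ks\<close> counts. As no round enlarges the instance,
  one bound \<open>n\<close> on the initial size limits the cost of every round.\<close>

lemma computes_loop:
  assumes "size (encode s) \<le> n"
  shows "computes kernel 1 [encode s, dl ks] (encode ((step ^^ length ks) s))
    (length ks * (step_cost n + 40) + 10)"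
  using assms
proof (induction ks arbitrary: s)
  case Nil
  show ?case by (rule computesI, subst kernel_1) simp
next
  case (Cons k ks)
  obtain vs es ns where s: "s = (vs, es, ns)" by (cases s)
  have S: "computes kernel 2 [dl vs, de es, dl ns, dl vs] (encode (step s)) (step_cost n)"
    using computes_step Cons.prems s by blast
  have IH: "computes kernel 1 [encode (step s), dl ks] (encode ((step ^^ length ks) (step s)))
    (length ks * (step_cost n + 40) + 10)"
    using Cons.IH size_step[of s] Cons.prems order_trans by blast
  have e: "encode s = Cell (dl vs) (Cell (de es) (dl ns))" using s by simp
  show ?case
    using computes_cost[OF S] computes_cost[OF IH]
    by (intro computesI, subst kernel_1)
      (simp add: e computes_wp[OF S] computes_wp[OF IH] funpow_swap1 del: One_nat_def)
qed

definition kernel_cost :: "nat \<Rightarrow> nat" where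
  "kernel_cost n = n * (step_cost n + 40) + 20"

lemma computes_kernel:
  "computes kernel 0 [encode (vs, es, ns)] (encode ((step ^^ length vs) (vs, es, ns)))
    (kernel_cost (size (encode (vs, es, ns))))"
proof -
  let ?n = "size (encode (vs, es, ns))"
  note L = computes_loop[of "(vs, es, ns)" ?n vs, OF order_refl]
  have "length vs \<le> ?n" using length_le_size[of "map dn vs"] by simp
  then have "length vs * (step_cost ?n + 40) \<le> ?n * (step_cost ?n + 40)" by (rule mult_le_mono1)
  then have "cost kernel 1 [encode (vs, es, ns), dl vs] \<le> ?n * (step_cost ?n + 40) + 10"
    using computes_cost[OF L] by linarith
  moreover have "head (encode (vs, es, ns)) = dl vs" by simp
  ultimately show ?thesis
    by (intro computesI, subst kernel_0)
      (simp add: computes_wp[OF L] kernel_cost_def del: encode.simps One_nat_def)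
qed

definition polynomial_bound :: "(nat \<Rightarrow> nat) \<Rightarrow> bool" where
  "polynomial_bound f \<longleftrightarrow> (\<exists>p :: nat poly. \<forall>n. f n = poly p n)"

lemma polynomial_bound_intros:
  "polynomial_bound (\<lambda>n. c)" "polynomial_bound (\<lambda>n. n)"
  "polynomial_bound f \<Longrightarrow> polynomial_bound g \<Longrightarrow> polynomial_bound (\<lambda>n. f n + g n)"
  "polynomial_bound f \<Longrightarrow> polynomial_bound g \<Longrightarrow> polynomial_bound (\<lambda>n. f n * g n)"
  unfolding polynomial_bound_def
     apply (rule exI[of _ "[:c:]"], simp)
    apply (rule exI[of _ "[:0, 1:]"], simp)
   apply (metis poly_add)
  apply (metis poly_mult)
  done

text \<open>The degrees are 2 for a list scan, 3 for a test of the rule, 4 for a round and 5 for all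
  rounds.\<close>

lemma polynomial_kernel_cost: "polynomial_bound kernel_cost"
  unfolding kernel_cost_def step_cost_def test_cost_def diff_cost_def scan_cost_def
  by (intro polynomial_bound_intros)

section \<open>Agreement of the list operations with the graph operations\<close>

definition lists_represent ::
    "instance_lists \<Rightarrow> nat set \<Rightarrow> nat set set \<Rightarrow> nat set \<Rightarrow> bool" where
  "lists_represent s V E N \<longleftrightarrow> (case s of (vs, es, ns) \<Rightarrow>
     distinct vs \<and> set vs = V \<and>
     distinct (map (\<lambda>(u, v). {u, v}) es) \<and> set (map (\<lambda>(u, v). {u, v}) es) = E \<and>
     distinct ns \<and> set ns = N)"

lemma represents_iff: "represents x V E N \<longleftrightarrow> (\<exists>s. lists_represent s V E N \<and> x = encode s)"
  by (auto simp: represents_def lists_represent_def)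

lemma set_neighbours: "set (neighbours v es) = nb (set (map (\<lambda>(u, v). {u, v}) es)) v"
  by (induction v es rule: neighbours.induct) (auto simp: nb_def doubleton_eq_iff)

text \<open>A neighbour listed twice would come from an edge listed twice.\<close>

lemma distinct_neighbours:
  "distinct (map (\<lambda>(u, v). {u, v}) es) \<Longrightarrow> distinct (neighbours v es)"
proof (induction v es rule: neighbours.induct)
  case (2 v x y es)
  then have d: "distinct (neighbours v es)" "{x, y} \<notin> set (map (\<lambda>(u, v). {u, v}) es)" by auto
  then have "v = x \<Longrightarrow> y \<notin> set (neighbours v es)" "v = y \<Longrightarrow> x \<notin> set (neighbours v es)"
    unfolding set_neighbours nb_def by (simp_all add: insert_commute)
  then show ?case using d(1) by auto
qed simp

lemma is_pair_iff: "distinct l \<Longrightarrow> is_pair l \<longleftrightarrow> card (set l) = 2"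
  by (simp add: is_pair_def distinct_card)

lemma applicable_iff:
  assumes "lists_represent (vs, es, ns) V E N"
  shows "applicable vs es ns b (neighbours b es) \<longleftrightarrow>
    (\<exists>a c. neighbours b es = [a, c] \<and> reducible V E N a b c)"
proof -
  have E: "set (neighbours v es) = nb E v" "distinct (neighbours v es)" for v
    using assms set_neighbours distinct_neighbours by (auto simp: lists_represent_def)
  have VN: "length (filter (\<lambda>u. u \<notin> N) vs) = card (V - N)"
    using assms by (simp add: lists_represent_def distinct_length_filter set_diff_eq Int_def conj_commute)
  have N: "set ns = N" using assms by (simp add: lists_represent_def)
  have "rule_test vs ns b a c (neighbours a es) (neighbours c es) \<longleftrightarrow> reducible V E N a b c"
    if "neighbours b es = [a, c]" for a c
  proof -
    have "nb E b = {a, c}" "a \<noteq> c" using that E[of b] by auto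
    moreover have "c \<notin> nb E a \<longleftrightarrow> {a, c} \<notin> E" by (simp add: nb_def insert_commute)
    ultimately show ?thesis
      unfolding rule_test_def reducible_def is_pair_iff[OF E(2)] E(1) N VN by blast
  qed
  then show ?thesis unfolding applicable_def by (metis is_pairE is_pair_def length_Cons
      list.size(3) nth_Cons_0 nth_Cons_Suc One_nat_def numeral_2_eq_2)
qed

text \<open>The neighbour list of \<open>b\<close> may present \<open>a\<close> and \<open>c\<close>
  in either order.\<close>

lemma reducible_swap: "reducible V E N a b c \<longleftrightarrow> reducible V E N c b a"
  unfolding reducible_def by (auto simp: insert_commute)

lemma scan_result:
  "scan vs es ns ws = (vs, es, ns) \<and> (\<forall>b\<in>set ws. \<not> applicable vs es ns b (neighbours b es)) \<or>
   (\<exists>b\<in>set ws. applicable vs es ns b (neighbours b es) \<and> scan vs es ns ws =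
     (filter (\<lambda>u. b \<noteq> u) vs, (neighbours b es ! 0, neighbours b es ! 1) # del_edges b es,
      filter (\<lambda>u. b \<noteq> u) ns))"
  by (induction ws) (auto simp: Let_def)

lemma represent_suppressed:
  assumes r: "lists_represent (vs, es, ns) V E N" and "simple_graph V E" "connected_graph V E"
    and red: "reducible V E N a b c"
  shows "lists_represent (filter (\<lambda>u. b \<noteq> u) vs, (a, c) # del_edges b es, filter (\<lambda>u. b \<noteq> u) ns)
    (V - {b}) (sup_edges E a b c) (N - {b})"
proof -
  interpret suppression V E a b c
    using assms by unfold_locales (auto simp: reducible_def)
  let ?m = "\<lambda>(u, v). {u, v} :: nat set"
  have E: "set (map ?m es) = E" "distinct (map ?m es)" using r by (auto simp: lists_represent_def)
  have "set (map ?m (del_edges b es)) = {e \<in> E. b \<notin> e}" using E(1) by auto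
  also have "\<dots> = E - {{a, b}, {b, c}}" using edges_at_b by auto
  finally have d: "set (map ?m (del_edges b es)) = E - {{a, b}, {b, c}}" .
  moreover have "distinct (map ?m (del_edges b es))" using E(2) by (simp add: distinct_map inj_on_def)
  moreover have "{a, c} \<notin> set (map ?m (del_edges b es))" unfolding d using nac by simp
  ultimately show ?thesis using r by (auto simp: lists_represent_def sup_edges_def)
qed

section \<open>Progress and invariants of the iteration\<close>

lemma step_irreducible:
  assumes "lists_represent s V E N" "\<nexists>a b c. reducible V E N a b c"
  shows "step s = s"
proof -
  obtain vs es ns where s: "s = (vs, es, ns)" by (cases s)
  then show ?thesis
    using scan_result[of vs es ns vs] applicable_iff assms by (metis step.simps)
qed

lemma step_reducible:
  assumes r: "lists_represent s V E N" and i: "ntst_instance V E N" and red: "reducible V E N a b c"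
  obtains V' E' N' where "lists_represent (step s) V' E' N'" "ntst_instance V' E' N'"
    "ntst_yes V E N \<longleftrightarrow> ntst_yes V' E' N'" "\<And>k. leafy V' E' k \<Longrightarrow> leafy V E k" "card V' < card V"
proof -
  obtain vs es ns where s: "s = (vs, es, ns)" by (cases s)
  note r' = r[unfolded s]
  have g: "simple_graph V E" "connected_graph V E" using i by (auto simp: ntst_instance_def)
  have E: "set (neighbours b es) = nb E b" "distinct (neighbours b es)"
    using r' set_neighbours distinct_neighbours by (auto simp: lists_represent_def)
  have nb: "nb E b = {a, c}" "a \<noteq> c" using red by (auto simp: reducible_def)
  then have "is_pair (neighbours b es)" using is_pair_iff[OF E(2)] E(1) by simp
  then obtain x y where xy: "neighbours b es = [x, y]" by (rule is_pairE)
  then have "x = a \<and> y = c \<or> x = c \<and> y = a" using E nb by (auto simp: doubleton_eq_iff)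
  then have "applicable vs es ns b (neighbours b es)"
    using applicable_iff[OF r'] xy red reducible_swap by metis
  moreover have "b \<in> set vs"
  proof -
    have "{a, b} \<in> E" using nb by (auto simp: nb_def)
    then have "b \<in> V" using simple_graph_edge g by metis
    then show ?thesis using r' by (simp add: lists_represent_def)
  qed
  \<comment> \<open>The scan stops at the first applicable vertex, which may differ from the given
    \<open>b\<close>.\<close>
  ultimately obtain b' where b': "applicable vs es ns b' (neighbours b' es)"
    and st: "step s = (filter (\<lambda>u. b' \<noteq> u) vs,
      (neighbours b' es ! 0, neighbours b' es ! 1) # del_edges b' es, filter (\<lambda>u. b' \<noteq> u) ns)"
    using scan_result[of vs es ns vs] s by auto
  then obtain a' c' where l: "neighbours b' es = [a', c']" and red': "reducible V E N a' b' c'"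
    using applicable_iff[OF r'] by blast
  interpret suppression V E a' b' c'
    using g red' by unfold_locales (auto simp: reducible_def)
  have "lists_represent (step s) (V - {b'}) (sup_edges E a' b' c') (N - {b'})"
    unfolding st l using represent_suppressed[OF r' g red'] by simp
  moreover have "finite V" using g by (simp add: simple_graph_def)
  then have "card (V - {b'}) < card V" using in_V(2) by (rule card_Diff1_less)
  ultimately show thesis
    using that ntst_instance_sup[OF i red'] ntst_yes_sup[OF red'] leafy_sup by blast
qed

text \<open>While the rule applies, every round removes a vertex; once it does not, the remaining
  rounds are idle. The clause on \<open>leafy\<close> relates the leaf counts of the result to the
  original graph.\<close>

lemma iterate_step:
  assumes "lists_represent s V E N" "ntst_instance V E N"
  shows "\<exists>V' E' N'. lists_represent ((step ^^ k) s) V' E' N' \<and> ntst_instance V' E' N' \<and>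
    (ntst_yes V E N \<longleftrightarrow> ntst_yes V' E' N') \<and> (\<forall>l. leafy V' E' l \<longrightarrow> leafy V E l) \<and>
    ((\<nexists>a b c. reducible V' E' N' a b c) \<or> card V' + k \<le> card V)"
proof (induction k)
  case 0
  then show ?case using assms by auto
next
  case (Suc k)
  then obtain V' E' N' where I: "lists_represent ((step ^^ k) s) V' E' N'" "ntst_instance V' E' N'"
    "ntst_yes V E N \<longleftrightarrow> ntst_yes V' E' N'" "\<forall>l. leafy V' E' l \<longrightarrow> leafy V E l"
    "(\<nexists>a b c. reducible V' E' N' a b c) \<or> card V' + k \<le> card V" by blast
  show ?case
  proof (cases "\<exists>a b c. reducible V' E' N' a b c")
    case False
    then have "(step ^^ Suc k) s = (step ^^ k) s" using step_irreducible[OF I(1)] by simp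
    then show ?thesis using I False by (intro exI[of _ V'] exI[of _ E'] exI[of _ N']) simp
  next
    case True
    then obtain a b c where "reducible V' E' N' a b c" by blast
    then obtain V'' E'' N'' where J: "lists_represent (step ((step ^^ k) s)) V'' E'' N''"
      "ntst_instance V'' E'' N''" "ntst_yes V' E' N' \<longleftrightarrow> ntst_yes V'' E'' N''"
      "\<And>k. leafy V'' E'' k \<Longrightarrow> leafy V' E' k" "card V'' < card V'"
      using step_reducible[OF I(1,2)] by metis
    have "card V'' + Suc k \<le> card V" using I(5) J(5) True by auto
    then show ?thesis using I J by (intro exI[of _ V''] exI[of _ E''] exI[of _ N'']) simp
  qed
qed

section \<open>Running time and size of the kernel\<close>

lemma runs_kernel:
  "\<exists>t \<le> kernel_cost (size (encode (vs, es, ns))).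
     runs kernel (encode (vs, es, ns)) (encode ((step ^^ length vs) (vs, es, ns))) t"
proof -
  have "kernel \<noteq> []" by (simp add: kernel_def)
  then show ?thesis using computes_kernel unfolding computes_def runs_def by blast
qed

lemma kernel_polynomial_time:
  "polynomial_time_on kernel {x. \<exists>V E N. ntst_instance V E N \<and> represents x V E N}"
proof -
  obtain p where p: "\<And>n. kernel_cost n = poly p n"
    using polynomial_kernel_cost by (auto simp: polynomial_bound_def)
  show ?thesis
    unfolding polynomial_time_on_def
  \<comment> \<open>The added identity covers the output, which is no larger than the input.\<close>
  proof (intro exI[of _ "p + [:0, 1:]"] ballI)
    fix x assume "x \<in> {x. \<exists>V E N. ntst_instance V E N \<and> represents x V E N}"
    then obtain vs es ns where x: "x = encode (vs, es, ns)"
      unfolding represents_iff by auto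
    obtain t where "t \<le> kernel_cost (size x)"
      "runs kernel x (encode ((step ^^ length vs) (vs, es, ns))) t"
      using runs_kernel x by blast
    then show "\<exists>y t. runs kernel x y t \<and> t \<le> poly (p + [:0, 1:]) (size x) \<and>
        size y \<le> poly (p + [:0, 1:]) (size x)"
      using size_step_iterate[of "length vs" "(vs, es, ns)"] p x
      by (intro exI[of _ "encode ((step ^^ length vs) (vs, es, ns))"] exI[of _ t]) simp
  qed
qed

theorem theorem4:
  shows "\<exists>(P :: program) (C :: nat).
     polynomial_time_on P {x. \<exists>V E N. ntst_instance V E N \<and> represents x V E N} \<and>
     (\<forall>V E N x. ntst_instance V E N \<and> represents x V E N \<longrightarrow>
        (\<exists>y t V' E' N'.
           runs P x y t \<and>
           ntst_instance V' E' N' \<and> represents y V' E' N' \<and>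
           (ntst_yes V E N \<longleftrightarrow> ntst_yes V' E' N') \<and>
           card V' \<le> C * (max_leaf_number V E)\<^sup>2))"
proof (rule exI[of _ kernel], rule exI[of _ 38], intro conjI allI impI)
  show "polynomial_time_on kernel {x. \<exists>V E N. ntst_instance V E N \<and> represents x V E N}"
    by (rule kernel_polynomial_time)
next
  fix V E N x assume *: "ntst_instance V E N \<and> represents x V E N"
  then obtain vs es ns where x: "x = encode (vs, es, ns)"
    and rep: "lists_represent (vs, es, ns) V E N" unfolding represents_iff by auto
  have i: "ntst_instance V E N" using * by blast
  have cV: "card V = length vs" using rep by (auto simp: lists_represent_def distinct_card)
  obtain V' E' N' where I: "lists_represent ((step ^^ length vs) (vs, es, ns)) V' E' N'"
    "ntst_instance V' E' N'" "ntst_yes V E N \<longleftrightarrow> ntst_yes V' E' N'"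
    "\<forall>l. leafy V' E' l \<longrightarrow> leafy V E l"
    "(\<nexists>a b c. reducible V' E' N' a b c) \<or> card V' + length vs \<le> card V"
    using iterate_step[OF rep i] by blast
  have V': "simple_graph V' E'" "connected_graph V' E'" "2 \<le> card V'"
    using I(2) by (auto simp: ntst_instance_def)
  \<comment> \<open>If all \<open>card V\<close> rounds had removed a vertex, none would be left,
    but an instance has at least two.\<close>
  then have irr: "\<nexists>a b c. reducible V' E' N' a b c" using I(5) cV by auto
  obtain k where k: "leafy V' E' k" "card V' \<le> 38 * k"
    using irreducible_card_bound[OF V'] irr by blast
  have "k \<le> max_leaf_number V E"
    using leafy_le_max_leaf_number[of V E k] I(4) k(1) i by (auto simp: ntst_instance_def)
  \<comment> \<open>The linear bound is weakened to the quadratic one.\<close>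
  also have "\<dots> \<le> (max_leaf_number V E)\<^sup>2" by (cases "max_leaf_number V E") (auto simp: power2_eq_square)
  finally have bound: "card V' \<le> 38 * (max_leaf_number V E)\<^sup>2" using k(2) by linarith
  obtain t where "runs kernel x (encode ((step ^^ length vs) (vs, es, ns))) t"
    using runs_kernel x by blast
  then show "\<exists>y t V' E' N'. runs kernel x y t \<and> ntst_instance V' E' N' \<and> represents y V' E' N' \<and>
      (ntst_yes V E N \<longleftrightarrow> ntst_yes V' E' N') \<and> card V' \<le> 38 * (max_leaf_number V E)\<^sup>2"
    using I bound unfolding represents_iff by blast
qed

end
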